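(* Let $\mathcal M\subset{}^d\mathcal K$ be a maximal isotropic subspace. Then the number of negative eigenvalues of $-\Delta(\mathcal M,\underline a)$, counted with multiplicity, is not bigger than $n_+(\mathcal M)$. If $\mathcal I=\emptyset$, then $-\Delta(\mathcal M)$ has precisely $n_+(\mathcal M)$ negative eigenvalues (counted with multiplicity).
   Context: Let $\mathcal G=(V,\mathcal I,\mathcal E,\partial)$ be a finite connected graph: $V$ a finite set of vertices, $\mathcal I$ a finite set of internal edges, $\mathcal E$ a finite set of external edges; $\partial$ assigns to each $i\in\mathcal I$ an ordered pair $(\partial^-(i),\partial^+(i))$ of (possibly equal) vertices and to each $e\in\mathcal E$ a single vertex $\partial(e)$. Fix lengths $\underline a=\{a_i\}_{i\in\mathcal I}$, $a_i>0$, and set $I_i=[0,a_i]$ for $i\in\mathcal I$, $I_e=[0,\infty)$ for $e\in\mathcal E$. Let $\mathcal H=\bigoplus_{j\in\mathcal E\cup\mathcal I}L^2(I_j)$ and let $\mathcal D$ be the set of $\psi=\{\psi_j\}\in\mathcal H$ with $\psi_j,\psi_j'$ absolutely continuous and $\psi_j''\in L^2(I_j)$. Let $\mathcal K=\mathcal K_{\mathcal E}\oplus\mathcal K^{(-)}_{\mathcal I}\oplus\mathcal K^{(+)}_{\mathcal I}$ with $\mathcal K_{\mathcal E}\cong\mathbb C^{|\mathcal E|}$, $\mathcal K^{(\pm)}_{\mathcal I}\cong\mathbb C^{|\mathcal I|}$, and ${}^d\mathcal K=\mathcal K\oplus\mathcal K$. For $\psi\in\mathcal D$ set $\underline\psi=(\{\psi_e(0)\}_{e\in\mathcal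 E},\{\psi_i(0)\}_{i\in\mathcal I},\{\psi_i(a_i)\}_{i\in\mathcal I})$, $\underline\psi'=(\{\psi_e'(0)\}_{e\in\mathcal E},\{\psi_i'(0)\}_{i\in\mathcal I},\{-\psi_i'(a_i)\}_{i\in\mathcal I})$, $[\psi]=\underline\psi\oplus\underline\psi'\in{}^d\mathcal K$. For linear maps $A,B:\mathcal K\to\mathcal K$ let $\mathcal M(A,B)=\{\chi_1\oplus\chi_2:A\chi_1+B\chi_2=0\}$. A subspace $\mathcal M\subset{}^d\mathcal K$ is maximal isotropic (for the form $\langle\chi,J\chi'\rangle$, $J=\begin{pmatrix}0&\mathbb I\\-\mathbb I&0\end{pmatrix}$) iff $\mathcal M=\mathcal M(A,B)$ for linear $A,B$ such that $(A,B):{}^d\mathcal K\to\mathcal K$ has rank $|\mathcal E|+2|\mathcal I|$ and $AB^\dagger$ is self-adjoint; $\mathcal M(A,B)=\mathcal M(A',B')$ iff $A'=CA,B'=CB$ for some invertible $C$. The Laplace operator $\Delta(\mathcal M,\underline a)$ is the self-adjoint operator $(\Delta\psi)_j=\psi_j''$ with domain $\{\psi\in\mathcal D:[\psi]\in\mathcal M\}$ (i.e. $A\underline\psi+B\underline\psi'=0$); if $\mathcal I=\emptyset$ it is written $\Delta(\mathcal M)$. For $\mathcal M=\mathcal M(A,B)$, $n_+(\mathcal M)$, $n_-(\mathcal M)$, $n_0(\mathcal M)$ denote the numbers of positive, negative and zero eigenvalues (with multiplicity) of the self-adjoint matrix $AB^\dagger$; these do not depend on the choice of $(A,B)$. *)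

theory Defs
  imports "HOL-Analysis.Analysis" "HOL-Library.Extended_Nat"
    "Jordan_Normal_Form.DL_Rank" "Jordan_Normal_Form.Schur_Decomposition"
    "Jordan_Normal_Form.Char_Poly"
begin

section \<open>The graph\<close>

text \<open>External edges are indexed by e < nE, internal edges by i < nI.
  bdE e is the vertex of the external edge e, (bdM i, bdP i) is the ordered pair
  of (possibly equal) vertices of the internal edge i.\<close>

definition graph_adj :: "nat \<Rightarrow> (nat \<Rightarrow> 'v) \<Rightarrow> (nat \<Rightarrow> 'v) \<Rightarrow> ('v \<times> 'v) set" where
  "graph_adj nI bdM bdP = {(bdM i, bdP i) | i. i < nI} \<union> {(bdP i, bdM i) | i. i < nI}"

definition finite_connected_graph ::
  "'v set \<Rightarrow> nat \<Rightarrow> nat \<Rightarrow> (nat \<Rightarrow> 'v) \<Rightarrow> (nat \<Rightarrow> 'v) \<Rightarrow> (nat \<Rightarrow> 'v) \<Rightarrow> bool" where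
  "finite_connected_graph V nE nI bdE bdM bdP \<longleftrightarrow>
     finite V \<and> V \<noteq> {} \<and>
     (\<forall>e<nE. bdE e \<in> V) \<and> (\<forall>i<nI. bdM i \<in> V \<and> bdP i \<in> V) \<and>
     (\<forall>u\<in>V. \<forall>w\<in>V. (u, w) \<in> (graph_adj nI bdM bdP)\<^sup>*)"

section \<open>Edges as intervals, Hilbert space components\<close>

text \<open>A vector of the (direct sum) function space is a function Psi :: nat => real => complex;
  component j < nE is the function on the external edge j (interval [0,inf)),
  component nE + i (i < nI) is the function on the internal edge i (interval [0, a i]).
  All other values are required to be zero.\<close>

definition edge_interval :: "nat \<Rightarrow> (nat \<Rightarrow> real) \<Rightarrow> nat \<Rightarrow> real set" where
  "edge_interval nE a j = (if j < nE then {0..} else {0 .. a (j - nE)})"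

text \<open>Absolute continuity of f on the interval S (with left endpoint 0), with derivative g:
  f(x) = f(0) + integral of g over [0,x], g Lebesgue integrable on every compact [0,t] in S
  (local absolute continuity for the half line).\<close>

definition abs_cont_with_deriv :: "real set \<Rightarrow> (real \<Rightarrow> complex) \<Rightarrow> (real \<Rightarrow> complex) \<Rightarrow> bool" where
  "abs_cont_with_deriv S f g \<longleftrightarrow>
     (\<forall>t\<in>S. g absolutely_integrable_on {0..t}) \<and>
     (\<forall>x\<in>S. f x = f 0 + integral {0..x} g)"

definition square_integrable_on :: "(real \<Rightarrow> complex) \<Rightarrow> real set \<Rightarrow> bool" where
  "square_integrable_on f S \<longleftrightarrow> f measurable_on S \<and> (\<lambda>x. (cmod (f x))\<^sup>2) integrable_on S"

text \<open>Psi belongs to the space D, with first derivatives Psi1 and second derivatives Psi2.\<close>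

definition in_D :: "nat \<Rightarrow> nat \<Rightarrow> (nat \<Rightarrow> real) \<Rightarrow>
    (nat \<Rightarrow> real \<Rightarrow> complex) \<Rightarrow> (nat \<Rightarrow> real \<Rightarrow> complex) \<Rightarrow> (nat \<Rightarrow> real \<Rightarrow> complex) \<Rightarrow> bool" where
  "in_D nE nI a Psi Psi1 Psi2 \<longleftrightarrow>
     (\<forall>j x. (j \<ge> nE + nI \<or> x \<notin> edge_interval nE a j) \<longrightarrow> Psi j x = 0) \<and>
     (\<forall>j < nE + nI.
        square_integrable_on (Psi j) (edge_interval nE a j) \<and>
        abs_cont_with_deriv (edge_interval nE a j) (Psi j) (Psi1 j) \<and>
        abs_cont_with_deriv (edge_interval nE a j) (Psi1 j) (Psi2 j) \<and>
        square_integrable_on (Psi2 j) (edge_interval nE a j))"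

text \<open>Boundary values: underline psi and underline psi' in K = C^(nE + 2 nI).\<close>

definition bval :: "nat \<Rightarrow> nat \<Rightarrow> (nat \<Rightarrow> real) \<Rightarrow> (nat \<Rightarrow> real \<Rightarrow> complex) \<Rightarrow> complex Matrix.vec" where
  "bval nE nI a Psi = Matrix.vec (nE + 2 * nI)
     (\<lambda>k. if k < nE + nI then Psi k 0 else Psi (k - nI) (a (k - nE - nI)))"

definition bder :: "nat \<Rightarrow> nat \<Rightarrow> (nat \<Rightarrow> real) \<Rightarrow> (nat \<Rightarrow> real \<Rightarrow> complex) \<Rightarrow> complex Matrix.vec" where
  "bder nE nI a Psi1 = Matrix.vec (nE + 2 * nI)
     (\<lambda>k. if k < nE + nI then Psi1 k 0 else - Psi1 (k - nI) (a (k - nE - nI)))"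

section \<open>Boundary conditions M(A,B) and the eigenspaces of -Delta(M(A,B), a)\<close>

text \<open>(A,B) defines a maximal isotropic subspace M(A,B).\<close>

definition max_isotropic_AB :: "nat \<Rightarrow> complex mat \<Rightarrow> complex mat \<Rightarrow> bool" where
  "max_isotropic_AB N A B \<longleftrightarrow>
     A \<in> carrier_mat N N \<and> B \<in> carrier_mat N N \<and>
     vec_space.rank N (mat_of_cols N (cols A @ cols B)) = N \<and>
     A * mat_adjoint B = mat_adjoint (A * mat_adjoint B)"

text \<open>Eigenspace of -Delta(M(A,B),a) at the (real) value lam:
  Psi in the domain ([psi] in M(A,B)) with -Psi'' = lam Psi almost everywhere.\<close>

definition eigenspace_neg_Laplacian ::
  "nat \<Rightarrow> nat \<Rightarrow> (nat \<Rightarrow> real) \<Rightarrow> complex mat \<Rightarrow> complex mat \<Rightarrow> real \<Rightarrow> (nat \<Rightarrow> real \<Rightarrow> complex) set" where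
  "eigenspace_neg_Laplacian nE nI a A B lam =
     {Psi. \<exists>Psi1 Psi2. in_D nE nI a Psi Psi1 Psi2 \<and>
        A *\<^sub>v bval nE nI a Psi + B *\<^sub>v bder nE nI a Psi1 = 0\<^sub>v (nE + 2 * nI) \<and>
        (\<forall>j < nE + nI. negligible {x \<in> edge_interval nE a j. - Psi2 j x \<noteq> complex_of_real lam * Psi j x})}"

text \<open>Linear independence of a finite family of functions over the complex numbers.\<close>

definition lin_indep_fun :: "(nat \<Rightarrow> real \<Rightarrow> complex) set \<Rightarrow> bool" where
  "lin_indep_fun F \<longleftrightarrow> finite F \<and>
     (\<forall>c. (\<lambda>j x. \<Sum>f\<in>F. c f * f j x) = (\<lambda>j x. 0) \<longrightarrow> (\<forall>f\<in>F. c f = 0))"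

text \<open>Dimension (possibly infinite) of a space of functions.\<close>

definition fun_dim :: "(nat \<Rightarrow> real \<Rightarrow> complex) set \<Rightarrow> enat" where
  "fun_dim S = Sup {enat (card F) | F. F \<subseteq> S \<and> lin_indep_fun F}"

definition is_eigenvalue_neg_Laplacian ::
  "nat \<Rightarrow> nat \<Rightarrow> (nat \<Rightarrow> real) \<Rightarrow> complex mat \<Rightarrow> complex mat \<Rightarrow> real \<Rightarrow> bool" where
  "is_eigenvalue_neg_Laplacian nE nI a A B lam \<longleftrightarrow>
     (\<exists>Psi \<in> eigenspace_neg_Laplacian nE nI a A B lam. Psi \<noteq> (\<lambda>j x. 0))"

text \<open>Number of negative eigenvalues of -Delta(M(A,B),a), counted with multiplicity
  (sum of dimensions of eigenspaces; possibly infinite).\<close>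

definition num_neg_eigenvalues :: "nat \<Rightarrow> nat \<Rightarrow> (nat \<Rightarrow> real) \<Rightarrow> complex mat \<Rightarrow> complex mat \<Rightarrow> enat" where
  "num_neg_eigenvalues nE nI a A B =
     Sup {(\<Sum>lam\<in>L. fun_dim (eigenspace_neg_Laplacian nE nI a A B lam)) | L.
            finite L \<and> (\<forall>lam\<in>L. lam < 0 \<and> is_eigenvalue_neg_Laplacian nE nI a A B lam)}"

section \<open>n_+ : number of positive eigenvalues of A B^dagger, with (algebraic) multiplicity\<close>

definition n_plus :: "complex mat \<Rightarrow> complex mat \<Rightarrow> nat" where
  "n_plus A B = (\<Sum>z \<in> {z. poly (char_poly (A * mat_adjoint B)) z = 0 \<and> z \<in> \<real> \<and> Re z > 0}.
                   Polynomial.order z (char_poly (A * mat_adjoint B)))"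

end

theory Submission
  imports Defs
begin

text \<open>For some real t > 0 the matrix C = B + t A is invertible, and then
  L = inv(C) A is hermitian. Diagonalizing L by a unitary W turns the boundary condition into the
  decoupled form (psi, psi') = (W P y, W Q y) with real diagonal matrices P = 1 - t D, Q = - D,
  and the matrix A B* becomes congruent to - P Q. By Sylvester's law of inertia, n_+ is
  the number of j with p_j q_j < 0.

  Upper bound: eigenfunctions for -kappa^2 are combinations of exp(kappa x) and exp(-kappa x).
  By Green's identity, the form <psi, psi'> = sum_j p_j q_j |y_j|^2 is negative definite on the
  span of any independent family of eigenfunctions with negative eigenvalues, so the size of the
  family is at most the number of negative p_j q_j. Equality without internal edges: each j with
  p_j q_j < 0 provides the eigenfunction w_j exp(-kappa x), where w_j is the j-th column of W
  and kappa = - q_j / p_j.\<close>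

text \<open>Both A and B may be singular, so the condition can in general be solved neither for psi
  nor for psi'. A real shift is what keeps the problem hermitian: for C = B + t A with t real,
  hermiticity of A B^dagger gives A C^dagger = C A^dagger, and L inherits it. The shift also yields
  p_j - t q_j = 1. Hence psi - t psi' = W y recovers y from the boundary data, and p_j, q_j never
  vanish together. No spectral theory of the unbounded operator enters. Only finitely many explicit
  eigenfunctions are compared at a time; orthogonality across eigenvalues comes from the reality of
  the products p_j q_j, which makes the boundary form hermitian. A decaying exponential on a half
  line has psi'(0) = - kappa psi(0), so direction j carries one exactly when q_j = - kappa p_j with
  kappa > 0, that is, when p_j q_j < 0. On an internal edge an exponential is felt at both ends, so
  its boundary data are no longer a free choice; the form argument survives, the construction does
  not.\<close>

no_notation Finite_Cartesian_Product.vec_nth (infixl "$" 90)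

section \<open>Hermitian matrices\<close>

lemma index_mat_adjoint [simp]:
  fixes A :: "complex mat"
  shows "i < dim_col A \<Longrightarrow> j < dim_row A \<Longrightarrow> mat_adjoint A $$ (i, j) = cnj (A $$ (j, i))"
  by (simp add: mat_adjoint_def mat_of_rows_def)

lemma dim_mat_adjoint [simp]:
  "dim_row (mat_adjoint A) = dim_col A" "dim_col (mat_adjoint A) = dim_row A"
  by (simp_all add: mat_adjoint_def)

lemma mat_adjoint_carrier [simp]:
  "A \<in> carrier_mat m n \<Longrightarrow> mat_adjoint A \<in> carrier_mat n m"
  by (intro carrier_matI) auto

lemma mat_adjoint_adjoint [simp]:
  fixes A :: "complex mat"
  shows "mat_adjoint (mat_adjoint A) = A"
  by (intro eq_matI) auto

lemma mat_adjoint_one [simp]: "mat_adjoint (1\<^sub>m n :: complex mat) = 1\<^sub>m n"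
  by (intro eq_matI) auto

lemma mat_adjoint_mult:
  fixes A B :: "complex mat"
  assumes "A \<in> carrier_mat m n" "B \<in> carrier_mat n k"
  shows "mat_adjoint (A * B) = mat_adjoint B * mat_adjoint A"
  using assms by (intro eq_matI) (auto simp: scalar_prod_def mult.commute)

lemma mat_adjoint_add:
  fixes A B :: "complex mat"
  assumes "A \<in> carrier_mat m n" "B \<in> carrier_mat m n"
  shows "mat_adjoint (A + B) = mat_adjoint A + mat_adjoint B"
  using assms by (intro eq_matI) auto

lemma mat_adjoint_smult:
  fixes A :: "complex mat"
  shows "mat_adjoint (c \<cdot>\<^sub>m A) = cnj c \<cdot>\<^sub>m mat_adjoint A"
  by (intro eq_matI) auto

section \<open>Real diagonal matrices\<close>

definition real_diag :: "nat \<Rightarrow> (nat \<Rightarrow> real) \<Rightarrow> complex mat" where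
  "real_diag n d = Matrix.mat n n (\<lambda>(i, j). if i = j then complex_of_real (d i) else 0)"

lemma real_diag_carrier [simp]: "real_diag n d \<in> carrier_mat n n"
  by (simp add: real_diag_def)

lemma dim_real_diag [simp]: "dim_row (real_diag n d) = n" "dim_col (real_diag n d) = n"
  by (simp_all add: real_diag_def)

lemma index_real_diag [simp]:
  "i < n \<Longrightarrow> j < n \<Longrightarrow> real_diag n d $$ (i, j) = (if i = j then complex_of_real (d i) else 0)"
  by (simp add: real_diag_def)

lemma mat_adjoint_real_diag [simp]: "mat_adjoint (real_diag n d) = real_diag n d"
  by (intro eq_matI) auto

lemma real_diag_mult_vec:
  "v \<in> carrier_vec n \<Longrightarrow> real_diag n d *\<^sub>v v = Matrix.vec n (\<lambda>j. complex_of_real (d j) * v $ j)"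
  by (intro eq_vecI) (auto simp: scalar_prod_def if_distrib[of "\<lambda>x. x * _"] cong: if_cong)

lemma real_diag_mult: "real_diag n d * real_diag n e = real_diag n (\<lambda>j. d j * e j)"
  by (intro eq_matI) (auto simp: scalar_prod_def if_distrib[of "\<lambda>x. x * _"] cong: if_cong)

lemma mult_real_diag_index:
  assumes "W \<in> carrier_mat m n" "i < m" "j < n"
  shows "(W * real_diag n d) $$ (i, j) = W $$ (i, j) * complex_of_real (d j)"
  using assms by (auto simp: scalar_prod_def if_distrib[of "\<lambda>x. _ * x"] cong: if_cong)

section \<open>Unitary diagonalization\<close>

text \<open>Gram-Schmidt keeps the first vector of its list, so a basis starting with v becomes an
  orthogonal one that still starts with v. Normalizing the columns only rescales it, whence the
  factor c.\<close>

lemma unitary_completion: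
  fixes v :: "complex vec"
  assumes v: "v \<in> carrier_vec n" and v0: "v \<noteq> 0\<^sub>v n"
  obtains W c where "W \<in> carrier_mat n n" "mat_adjoint W * W = 1\<^sub>m n"
    "c \<noteq> 0" "col W 0 = c \<cdot>\<^sub>v v"
proof -
  interpret cof_vec_space n "TYPE(complex)" .
  have n: "n > 0"
  proof (rule ccontr)
    assume "\<not> n > 0"
    then have "v = 0\<^sub>v n" using v by auto
    with v0 show False by simp
  qed
  define b where "b = basis_completion v"
  define ws where "ws = gram_schmidt n b"
  from basis_completion[OF v v0, folded b_def]
  have dist_b: "distinct b" and indep: "\<not> lin_dep (set b)" and b: "set b \<subseteq> carrier_vec n"
    and hdb: "hd b = v" and len_b: "length b = n" by auto
  from hdb len_b n obtain vs where bv: "b = v # vs" by (cases b) auto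
  from gram_schmidt_result[OF b dist_b indep refl, folded ws_def]
  have ws: "set ws \<subseteq> carrier_vec n" "corthogonal ws" "length ws = n"
    by (auto simp: len_b)
  have hdws: "hd ws = v"
    using gram_schmidt_hd[OF v, of vs, folded bv] unfolding ws_def .
  have wsi: "ws ! i \<in> carrier_vec n" if "i < n" for i
    using ws that by auto
  define s where "s i = (\<Sum>k<n. (cmod (ws ! i $ k))\<^sup>2)" for i
  have dot: "(\<Sum>k<n. cnj (ws ! i $ k) * ws ! j $ k) = (if i = j then complex_of_real (s i) else 0)"
    if "i < n" "j < n" for i j
  proof (cases "i = j")
    case True
    then show ?thesis
      by (simp add: s_def complex_norm_square mult.commute del: of_real_power)
  next
    case False
    have "ws ! j \<bullet>c ws ! i = 0"
      using corthogonalD[OF ws(2)] False that ws(3) by auto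
    then show ?thesis
      using False wsi[OF that(1)] wsi[OF that(2)]
      by (simp add: scalar_prod_def lessThan_atLeast0 mult.commute)
  qed
  have s_pos: "s i > 0" if "i < n" for i
  proof -
    have "ws ! i \<bullet>c ws ! i \<noteq> 0"
      using corthogonalD[OF ws(2)] that ws(3) by auto
    then have "(\<Sum>k<n. cnj (ws ! i $ k) * ws ! i $ k) \<noteq> 0"
      using wsi[OF that] by (simp add: scalar_prod_def lessThan_atLeast0 mult.commute)
    then have "s i \<noteq> 0" using dot[OF that that] by auto
    moreover have "s i \<ge> 0" by (auto simp: s_def intro: sum_nonneg)
    ultimately show ?thesis by simp
  qed
  \<comment> \<open>The vectors \<open>ws\<close> are orthogonal but not normalized;
    \<open>s i\<close> is the squared length of the i-th one.\<close>
  define W where "W = Matrix.mat n n (\<lambda>(k, i). complex_of_real (1 / sqrt (s i)) * ws ! i $ k)"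
  have W: "W \<in> carrier_mat n n" by (simp add: W_def)
  have "mat_adjoint W * W = 1\<^sub>m n"
  proof (intro eq_matI)
    fix i j assume "i < dim_row (1\<^sub>m n :: complex mat)" "j < dim_col (1\<^sub>m n :: complex mat)"
    then have ij: "i < n" "j < n" by auto
    have "(mat_adjoint W * W) $$ (i, j)
        = (\<Sum>k<n. complex_of_real (1 / sqrt (s i)) * complex_of_real (1 / sqrt (s j)) *
            (cnj (ws ! i $ k) * ws ! j $ k))"
      using ij W by (simp add: scalar_prod_def lessThan_atLeast0) (simp add: W_def mult_ac)
    also have "\<dots> = complex_of_real (1 / sqrt (s i)) * complex_of_real (1 / sqrt (s j)) *
        (if i = j then complex_of_real (s i) else 0)"
      by (simp add: sum_distrib_left[symmetric] dot[OF ij] del: of_real_divide)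
    also have "\<dots> = 1\<^sub>m n $$ (i, j)"
      using ij s_pos[of i]
      by (auto simp: of_real_mult[symmetric] simp del: of_real_mult of_real_divide)
    finally show "(mat_adjoint W * W) $$ (i, j) = 1\<^sub>m n $$ (i, j)" .
  qed (use W in auto)
  moreover have "col W 0 = complex_of_real (1 / sqrt (s 0)) \<cdot>\<^sub>v v"
  proof -
    have "ws ! 0 = v" using hdws ws(3) n by (metis hd_conv_nth length_greater_0_conv)
    then show ?thesis using n v by (intro eq_vecI) (auto simp: W_def)
  qed
  moreover have "complex_of_real (1 / sqrt (s 0)) \<noteq> 0"
    using s_pos[OF n] by simp
  ultimately show thesis using that[OF W] by blast
qed

text \<open>Deflation: in a unitary basis whose first vector is an eigenvector, the first column is
  e times a unit vector. Hermiticity clears the first row as well and leaves a smaller hermitian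
  block.\<close>

theorem hermitian_diagonalization:
  fixes L :: "complex mat"
  assumes "L \<in> carrier_mat n n" "mat_adjoint L = L"
  obtains W d where "W \<in> carrier_mat n n" "mat_adjoint W * W = 1\<^sub>m n"
    "W * mat_adjoint W = 1\<^sub>m n" "L = W * real_diag n d * mat_adjoint W"
proof -
  \<comment> \<open>The induction carries the intertwining form
    \<open>L * W = W * real_diag n d\<close> and one unitarity relation; the other relation follows
    at the end because a left inverse of a square matrix is a right inverse.\<close>
  have "\<exists>W d. W \<in> carrier_mat n n \<and> mat_adjoint W * W = 1\<^sub>m n \<and> L * W = W * real_diag n d"
    using assms
  proof (induction n arbitrary: L)
    case 0
    then show ?case
      by (intro exI[of _ "1\<^sub>m 0"] exI[of _ "\<lambda>_. 0"]) auto
  next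
    case (Suc m)
    note L = Suc.prems(1) and herm = Suc.prems(2)
    note assoc = assoc_mult_mat[of _ "Suc m" "Suc m" _ "Suc m" _ "Suc m"]
      mult_carrier_mat[of _ "Suc m" "Suc m" _ "Suc m"]
    obtain as where as: "char_poly L = (\<Prod>a\<leftarrow>as. [:- a, 1:])" "length as = Suc m"
      using char_poly_factorized[OF L] by blast
    then obtain e where "e \<in> set as" by (cases as) auto
    then have "poly (char_poly L) e = 0"
      unfolding as(1) poly_prod_list by (auto simp: prod_list_zero_iff image_iff)
    then have "eigenvalue L e"
      using eigenvalue_root_char_poly[OF L] by simp
    then obtain v where v: "v \<in> carrier_vec (Suc m)" "v \<noteq> 0\<^sub>v (Suc m)" "L *\<^sub>v v = e \<cdot>\<^sub>v v"
      using L unfolding eigenvalue_def eigenvector_def by auto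
    obtain U c where U: "U \<in> carrier_mat (Suc m) (Suc m)" "mat_adjoint U * U = 1\<^sub>m (Suc m)"
      and c: "c \<noteq> 0" "col U 0 = c \<cdot>\<^sub>v v"
      using unitary_completion[OF v(1,2)] by blast
    have U': "U * mat_adjoint U = 1\<^sub>m (Suc m)"
      using mat_mult_left_right_inverse[OF _ U(1) U(2)] U by simp
    have LU0: "L *\<^sub>v col U 0 = e \<cdot>\<^sub>v col U 0"
      using L v by (simp add: c mult_mat_vec smult_smult_assoc mult.commute)
    define T where "T = mat_adjoint U * L * U"
    have T: "T \<in> carrier_mat (Suc m) (Suc m)" using U L by (auto simp: T_def)
    have T_eq: "T = mat_adjoint U * (L * U)"
      unfolding T_def using U L by (intro assoc_mult_mat) auto
    have adjT: "mat_adjoint T = T"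
      unfolding T_eq using U L herm
      by (simp add: mat_adjoint_mult[of _ "Suc m" "Suc m" _ "Suc m"]
          assoc)
    have T0: "T $$ (i, 0) = (if i = 0 then e else 0)" if i: "i < Suc m" for i
    proof -
      have "T $$ (i, 0) = row (mat_adjoint U) i \<bullet> (L *\<^sub>v col U 0)"
        unfolding T_eq using U L i by (subst index_mult_mat) (auto simp: mult_mat_vec_def)
      also have "\<dots> = e * (row (mat_adjoint U) i \<bullet> col U 0)"
        unfolding LU0 using U i col_dim[of U 0] by (subst scalar_prod_smult_distrib[of _ "Suc m"]) auto
      also have "row (mat_adjoint U) i \<bullet> col U 0 = (mat_adjoint U * U) $$ (i, 0)"
        using U i by (subst index_mult_mat) auto
      finally show ?thesis using U i by auto
    qed
    have T0': "T $$ (0, i) = (if i = 0 then e else 0)" if i: "i < Suc m" for i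
    proof -
      have "T $$ (0, i) = cnj (T $$ (i, 0))"
        using arg_cong[OF adjT, of "\<lambda>M. M $$ (0, i)"] i T by auto
      moreover have "T $$ (0, 0) = cnj (T $$ (0, 0))"
        using arg_cong[OF adjT, of "\<lambda>M. M $$ (0, 0)"] T by auto
      ultimately show ?thesis using T0[OF i] T0[of 0] by (auto split: if_splits)
    qed
    \<comment> \<open>As a diagonal entry of the hermitian T, the eigenvalue e is real, so
      \<open>Re e\<close> may serve as the new entry of \<open>real_diag\<close>.\<close>
    have e_real: "complex_of_real (Re e) = e"
    proof -
      have "T $$ (0, 0) = cnj (T $$ (0, 0))"
        using arg_cong[OF adjT, of "\<lambda>M. M $$ (0, 0)"] T by auto
      then have "cnj e = e" using T0[of 0] by simp
      then show ?thesis by (simp add: complex_eq_iff)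
    qed
    define T3 where "T3 = Matrix.mat m m (\<lambda>(i, j). T $$ (Suc i, Suc j))"
    have T3: "T3 \<in> carrier_mat m m" by (simp add: T3_def)
    have adjT3: "mat_adjoint T3 = T3"
    proof (intro eq_matI)
      fix i j assume "i < dim_row T3" "j < dim_col T3"
      then have ij: "i < m" "j < m" using T3 by auto
      have "mat_adjoint T $$ (Suc i, Suc j) = T $$ (Suc i, Suc j)" by (simp add: adjT)
      then show "mat_adjoint T3 $$ (i, j) = T3 $$ (i, j)"
        using ij T by (simp add: T3_def)
    qed (use T3 in auto)
    obtain V d where V: "V \<in> carrier_mat m m" "mat_adjoint V * V = 1\<^sub>m m"
      "T3 * V = V * real_diag m d"
      using Suc.IH[OF T3 adjT3] by blast
    define X where "X = four_block_mat (1\<^sub>m 1) (0\<^sub>m 1 m) (0\<^sub>m m 1) V"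
    define d' where "d' i = (case i of 0 \<Rightarrow> Re e | Suc j \<Rightarrow> d j)" for i
    have X: "X \<in> carrier_mat (Suc m) (Suc m)"
      unfolding X_def using V by (metis four_block_carrier_mat one_carrier_mat plus_1_eq_Suc)
    have T_block: "T = four_block_mat (e \<cdot>\<^sub>m 1\<^sub>m 1) (0\<^sub>m 1 m) (0\<^sub>m m 1) T3"
    proof (intro eq_matI)
      fix i j
      assume "i < dim_row (four_block_mat (e \<cdot>\<^sub>m 1\<^sub>m 1) (0\<^sub>m 1 m) (0\<^sub>m m 1) T3)"
        "j < dim_col (four_block_mat (e \<cdot>\<^sub>m 1\<^sub>m 1) (0\<^sub>m 1 m) (0\<^sub>m m 1) T3)"
      then have "i < Suc m" "j < Suc m" using T3 by auto
      then show "T $$ (i, j) = four_block_mat (e \<cdot>\<^sub>m 1\<^sub>m 1) (0\<^sub>m 1 m) (0\<^sub>m m 1) T3 $$ (i, j)"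
        using T3 T0[of i] T0'[of j] by (cases i; cases j) (auto simp: T3_def)
    qed (use T T3 in auto)
    have D_block: "real_diag (Suc m) d' = four_block_mat (e \<cdot>\<^sub>m 1\<^sub>m 1) (0\<^sub>m 1 m) (0\<^sub>m m 1) (real_diag m d)"
      by (intro eq_matI) (auto simp: d'_def e_real split: nat.splits)
    have adjX: "mat_adjoint X = four_block_mat (1\<^sub>m 1) (0\<^sub>m 1 m) (0\<^sub>m m 1) (mat_adjoint V)"
      unfolding X_def using V by (intro eq_matI) auto
    have XX: "mat_adjoint X * X = 1\<^sub>m (Suc m)"
      unfolding adjX unfolding X_def using V
      by (subst mult_four_block_mat[of _ 1 1 _ m _ m _ _ 1 _ m]) auto
    have TX: "T * X = X * real_diag (Suc m) d'"
      unfolding T_block X_def D_block using V T3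
      by (subst (1 2) mult_four_block_mat[of _ 1 1 _ m _ m _ _ 1 _ m]) auto
    have "mat_adjoint (U * X) * (U * X) = mat_adjoint X * (mat_adjoint U * U) * X"
      using U(1) X by (simp add: mat_adjoint_mult[of _ "Suc m" "Suc m" _ "Suc m"]
          assoc)
    then have 1: "mat_adjoint (U * X) * (U * X) = 1\<^sub>m (Suc m)"
      using U X XX by simp
    have "L * (U * X) = (U * mat_adjoint U) * L * (U * X)"
      using U' L by simp
    also have "\<dots> = U * (T * X)"
      unfolding T_def using U(1) X L
      by (simp add: assoc)
    also have "\<dots> = U * X * real_diag (Suc m) d'"
      unfolding TX using U X by (simp add: assoc)
    finally show ?case using 1 U X by (intro exI[of _ "U * X"] exI[of _ d']) auto
  qed
  then obtain W d where W: "W \<in> carrier_mat n n" "mat_adjoint W * W = 1\<^sub>m n"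
    "L * W = W * real_diag n d" by blast
  have W': "W * mat_adjoint W = 1\<^sub>m n"
    using mat_mult_left_right_inverse[OF _ W(1) W(2)] W by simp
  have "L = L * (W * mat_adjoint W)"
    using W' assms by simp
  also have "\<dots> = W * real_diag n d * mat_adjoint W"
    unfolding W(3)[symmetric] using W(1) assms by (intro assoc_mult_mat[symmetric]) auto
  finally show thesis using that W W' by blast
qed

section \<open>Inertia\<close>

text \<open>Gaussian elimination, by induction on the equations: a zero equation is dropped, any
  other one is used to eliminate one unknown, which keeps the count of equations below that of
  unknowns.\<close>

lemma underdetermined_system:
  fixes m :: "'j \<Rightarrow> 'k \<Rightarrow> 'a :: field"
  assumes "finite J" "finite K" "card J < card K"
  shows "\<exists>c. (\<exists>k\<in>K. c k \<noteq> 0) \<and> (\<forall>j\<in>J. (\<Sum>k\<in>K. c k * m j k) = 0)"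
  using assms
proof (induction J arbitrary: K m rule: finite_induct)
  case empty
  then have "K \<noteq> {}" by auto
  then obtain k where "k \<in> K" by blast
  then show ?case by (intro exI[of _ "\<lambda>_. 1"]) auto
next
  case (insert j J)
  show ?case
  proof (cases "\<forall>k\<in>K. m j k = 0")
    case True
    obtain c where c: "\<exists>k\<in>K. c k \<noteq> 0" "\<forall>j\<in>J. (\<Sum>k\<in>K. c k * m j k) = 0"
      using insert.IH[of K m] insert.prems insert.hyps by auto
    then show ?thesis using True by (intro exI[of _ c]) auto
  next
    case False
    then obtain k0 where k0: "k0 \<in> K" "m j k0 \<noteq> 0" by blast
    define K' where "K' = K - {k0}"
    \<comment> \<open>The remaining system after equation j has been used to eliminate the unknown
      k0; its row j is zero.\<close>
    define m' where "m' i k = m i k - m i k0 * m j k / m j k0" for i k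
    have "card J < card K'"
      using insert.prems insert.hyps k0 by (simp add: K'_def card_Diff_singleton)
    then obtain c where c: "\<exists>k\<in>K'. c k \<noteq> 0" "\<forall>i\<in>J. (\<Sum>k\<in>K'. c k * m' i k) = 0"
      using insert.IH[of K' m'] insert.prems by (auto simp: K'_def)
    \<comment> \<open>The value at k0 solves equation j. With it, every equation of the old system
      at \<open>c'\<close> has the same value as its reduced version at \<open>c\<close>.\<close>
    define c' where "c' = c(k0 := - (\<Sum>k\<in>K'. c k * m j k) / m j k0)"
    have split: "(\<Sum>k\<in>K. c' k * m i k) = (\<Sum>k\<in>K'. c k * m' i k)" for i
    proof -
      have "(\<Sum>k\<in>K. c' k * m i k) = c' k0 * m i k0 + (\<Sum>k\<in>K'. c' k * m i k)"
        using insert.prems k0 unfolding K'_def by (intro sum.remove) auto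
      also have "(\<Sum>k\<in>K'. c' k * m i k) = (\<Sum>k\<in>K'. c k * m i k)"
        by (intro sum.cong) (auto simp: c'_def K'_def)
      also have "c' k0 * m i k0 + \<dots> = (\<Sum>k\<in>K'. c k * m' i k)"
        by (simp add: c'_def m'_def right_diff_distrib sum_subtractf sum_distrib_left
            sum_distrib_right sum_divide_distrib mult_ac)
      finally show ?thesis .
    qed
    have "(\<Sum>k\<in>K'. c k * m' j k) = 0"
      using k0 by (intro sum.neutral) (simp add: m'_def)
    then have "\<forall>i\<in>insert j J. (\<Sum>k\<in>K. c' k * m i k) = 0"
      unfolding split using c by auto
    moreover have "\<exists>k\<in>K. c' k \<noteq> 0"
      using c(1) by (auto simp: c'_def K'_def)
    ultimately show ?thesis by blast
  qed
qed

text \<open>With more vectors than positive weights, some nontrivial combination would vanish in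
  every positively weighted coordinate, and the form would be nonpositive there. This serves both
  Sylvester's law and the bound on independent eigenfunctions.\<close>

lemma card_le_positive_index:
  fixes f :: "'j \<Rightarrow> real" and y :: "'k \<Rightarrow> 'j \<Rightarrow> complex"
  assumes "finite J" "finite K"
    and pos: "\<And>c. \<exists>k\<in>K. c k \<noteq> 0 \<Longrightarrow> (\<Sum>j\<in>J. f j * (cmod (\<Sum>k\<in>K. c k * y k j))\<^sup>2) > 0"
  shows "card K \<le> card {j\<in>J. f j > 0}"
proof (rule ccontr)
  assume "\<not> card K \<le> card {j\<in>J. f j > 0}"
  then obtain c where c: "\<exists>k\<in>K. c k \<noteq> 0"
    "\<forall>j\<in>{j\<in>J. f j > 0}. (\<Sum>k\<in>K. c k * y k j) = 0"
    using underdetermined_system[of "{j\<in>J. f j > 0}" K "\<lambda>j k. y k j"] assms(1,2) by auto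
  have "(\<Sum>j\<in>J. f j * (cmod (\<Sum>k\<in>K. c k * y k j))\<^sup>2) \<le> 0"
  proof (intro sum_nonpos)
    fix j assume "j \<in> J"
    then show "f j * (cmod (\<Sum>k\<in>K. c k * y k j))\<^sup>2 \<le> 0"
      using c(2) by (cases "f j > 0") (auto simp: mult_nonpos_nonneg)
  qed
  with pos[OF c(1)] show False by simp
qed

text \<open>One half of Sylvester's law. The conjugated rows of G with \<open>e k > 0\<close> span a
  space on which the form with weights f takes the value of the sum of \<open>e k\<close> times the
  squared modulus of \<open>c k\<close>. No inverse of G is involved, so the other half is the same
  statement with e and f exchanged.\<close>

lemma inertia_le:
  assumes G: "G \<in> carrier_mat n n"
    and eq: "real_diag n e = G * real_diag n f * mat_adjoint G"
  shows "card {j. j < n \<and> e j > 0} \<le> card {j. j < n \<and> f j > 0}"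
proof -
  have entry: "(\<Sum>j<n. G $$ (k, j) * complex_of_real (f j) * cnj (G $$ (l, j)))
      = (if k = l then complex_of_real (e k) else 0)" if "k < n" "l < n" for k l
  proof -
    have "(if k = l then complex_of_real (e k) else 0) = real_diag n e $$ (k, l)"
      using that by simp
    also have "\<dots> = (\<Sum>j<n. (G * real_diag n f) $$ (k, j) * mat_adjoint G $$ (j, l))"
      unfolding eq using that G by (simp add: scalar_prod_def lessThan_atLeast0)
    also have "\<dots> = (\<Sum>j<n. G $$ (k, j) * complex_of_real (f j) * cnj (G $$ (l, j)))"
      using that G by (intro sum.cong refl) (simp add: mult_real_diag_index del: index_mult_mat)
    finally show ?thesis by simp
  qed
  let ?K = "{k. k < n \<and> e k > 0}"
  have "card ?K \<le> card {j\<in>{..<n}. f j > 0}"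
  proof (rule card_le_positive_index)
    fix c :: "nat \<Rightarrow> complex" assume c: "\<exists>k\<in>?K. c k \<noteq> 0"
    have "complex_of_real (\<Sum>j<n. f j * (cmod (\<Sum>k\<in>?K. c k * cnj (G $$ (k, j))))\<^sup>2)
        = (\<Sum>j<n. complex_of_real (f j) * ((\<Sum>k\<in>?K. c k * cnj (G $$ (k, j))) *
            (\<Sum>l\<in>?K. cnj (c l) * G $$ (l, j))))"
      by (simp add: complex_norm_square del: of_real_power)
    also have "\<dots> = (\<Sum>j<n. \<Sum>k\<in>?K. \<Sum>l\<in>?K. c k * cnj (c l) *
        (G $$ (l, j) * complex_of_real (f j) * cnj (G $$ (k, j))))"
      by (simp only: sum_product) (simp add: sum_distrib_left mult_ac)
    also have "\<dots> = (\<Sum>k\<in>?K. \<Sum>j<n. \<Sum>l\<in>?K. c k * cnj (c l) *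
        (G $$ (l, j) * complex_of_real (f j) * cnj (G $$ (k, j))))"
      by (rule sum.swap)
    also have "\<dots> = (\<Sum>k\<in>?K. \<Sum>l\<in>?K. \<Sum>j<n. c k * cnj (c l) *
        (G $$ (l, j) * complex_of_real (f j) * cnj (G $$ (k, j))))"
      by (intro sum.cong refl sum.swap)
    also have "\<dots> = (\<Sum>k\<in>?K. \<Sum>l\<in>?K. if l = k then c k * cnj (c k) * complex_of_real (e k) else 0)"
      by (intro sum.cong refl) (simp add: sum_distrib_left[symmetric] entry)
    also have "\<dots> = (\<Sum>k\<in>?K. c k * cnj (c k) * complex_of_real (e k))"
      by (intro sum.cong refl) simp
    also have "\<dots> = complex_of_real (\<Sum>k\<in>?K. (cmod (c k))\<^sup>2 * e k)"
      by (simp add: complex_norm_square del: of_real_power)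
    finally have "(\<Sum>j<n. f j * (cmod (\<Sum>k\<in>?K. c k * cnj (G $$ (k, j))))\<^sup>2)
        = (\<Sum>k\<in>?K. (cmod (c k))\<^sup>2 * e k)"
      by (simp only: of_real_eq_iff)
    also have "\<dots> > 0"
    proof -
      obtain k where "k \<in> ?K" "c k \<noteq> 0" using c by blast
      then show ?thesis by (intro sum_pos2[of _ k]) auto
    qed
    finally show "(\<Sum>j<n. f j * (cmod (\<Sum>k\<in>?K. c k * cnj (G $$ (k, j))))\<^sup>2) > 0" .
  qed auto
  then show ?thesis by simp
qed

section \<open>Positive eigenvalues and Sylvester's law\<close>

lemma order_prod_linear_factors:
  fixes a :: "'j \<Rightarrow> 'a :: idom"
  assumes "finite J"
  shows "Polynomial.order z (\<Prod>j\<in>J. [:- a j, 1:]) = card {j\<in>J. a j = z}"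
  using assms
proof (induction rule: finite_induct)
  case empty
  then show ?case by (simp add: order_0I)
next
  case (insert i J)
  have "(\<Prod>j\<in>insert i J. [:- a j, 1:]) \<noteq> 0"
    using insert.hyps by (simp only: prod_zero_iff finite_insert) auto
  then have "Polynomial.order z (\<Prod>j\<in>insert i J. [:- a j, 1:])
      = Polynomial.order z [:- a i, 1:] + card {j\<in>J. a j = z}"
    using insert order_mult[of "[:- a i, 1:]" "\<Prod>j\<in>J. [:- a j, 1:]" z]
    by (simp only: prod.insert not_False_eq_True)
  moreover have "Polynomial.order z [:- a i, 1:] = (if a i = z then 1 else 0)"
    using order_power_n_n[of z 1] by (auto intro: order_0I)
  moreover have "{j\<in>insert i J. a j = z} = (if a i = z then insert i {j\<in>J. a j = z} else {j\<in>J. a j = z})"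
    by auto
  ultimately show ?case using insert.hyps by auto
qed

lemma char_poly_real_diag:
  "char_poly (real_diag n d) = (\<Prod>j<n. [:- complex_of_real (d j), 1:])"
proof -
  have "char_poly (real_diag n d) = (\<Prod>a\<leftarrow>diag_mat (real_diag n d). [:- a, 1:])"
    by (rule char_poly_upper_triangular[of _ n]) auto
  also have "diag_mat (real_diag n d) = map (\<lambda>j. complex_of_real (d j)) [0..<n]"
    by (auto simp: diag_mat_def)
  finally show ?thesis
    by (simp add: o_def prod.list_conv_set_nth lessThan_atLeast0)
qed

text \<open>The sum in \<open>n_plus\<close> as a function of one matrix. It depends on the
  characteristic polynomial alone, hence is invariant under similarity.\<close>

definition pos_eigenvalue_count :: "complex mat \<Rightarrow> nat" where
  "pos_eigenvalue_count S = (\<Sum>z \<in> {z. poly (char_poly S) z = 0 \<and> z \<in> \<real> \<and> Re z > 0}.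
     Polynomial.order z (char_poly S))"

lemma pos_eigenvalue_count_real_diag:
  "pos_eigenvalue_count (real_diag n d) = card {j. j < n \<and> d j > 0}"
proof -
  let ?Z = "complex_of_real ` (d ` {j. j < n \<and> d j > 0})"
  have "poly (char_poly (real_diag n d)) z = (\<Prod>j<n. z - complex_of_real (d j))" for z
    unfolding char_poly_real_diag Polynomial.poly_prod by simp
  then have roots: "{z. poly (char_poly (real_diag n d)) z = 0 \<and> z \<in> \<real> \<and> Re z > 0} = ?Z"
    by auto
  have "pos_eigenvalue_count (real_diag n d)
      = (\<Sum>z\<in>?Z. card {j\<in>{j. j < n \<and> d j > 0}. complex_of_real (d j) = z})"
    unfolding pos_eigenvalue_count_def roots unfolding char_poly_real_diag
    by (intro sum.cong refl)
      (auto simp: order_prod_linear_factors intro!: arg_cong[of _ _ card])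
  \<comment> \<open>The order of a root z is the size of the fibre of d over z; the fibres partition
    the index set.\<close>
  also have "\<dots> = card {j. j < n \<and> d j > 0}"
    using sum.image_gen[of "{j. j < n \<and> d j > 0}" "\<lambda>_. 1::nat" "\<lambda>j. complex_of_real (d j)"]
    by (simp add: image_image)
  finally show ?thesis .
qed

text \<open>The unitary diagonalization of S is a similarity as well as a congruence: as a
  similarity it preserves the eigenvalue count, as a congruence it can be composed with X in both
  directions and compared by \<open>inertia_le\<close>.\<close>

theorem sylvester_inertia:
  assumes X: "X \<in> carrier_mat n n" "Y \<in> carrier_mat n n" "Y * X = 1\<^sub>m n"
    and S: "S = X * real_diag n f * mat_adjoint X"
  shows "pos_eigenvalue_count S = card {j. j < n \<and> f j > 0}"
proof -
  note assoc = assoc_mult_mat[of _ n n _ n _ n] mult_carrier_mat[of _ n n _ n] and adj = mat_adjoint_mult[of _ n n _ n]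
  have Sc: "S \<in> carrier_mat n n" and adjS: "mat_adjoint S = S"
    unfolding S using X(1) by (auto simp: adj assoc)
  obtain V e where V: "V \<in> carrier_mat n n" "mat_adjoint V * V = 1\<^sub>m n" "V * mat_adjoint V = 1\<^sub>m n"
    and SV: "S = V * real_diag n e * mat_adjoint V"
    using hermitian_diagonalization[OF Sc adjS] .
  have VSV: "real_diag n e = mat_adjoint V * S * V"
  proof -
    have "mat_adjoint V * S * V = (mat_adjoint V * V) * real_diag n e * (mat_adjoint V * V)"
      unfolding SV using V(1) by (simp add: assoc)
    then show ?thesis using V by simp
  qed
  have YSY: "real_diag n f = Y * S * mat_adjoint Y"
  proof -
    have "Y * S * mat_adjoint Y = (Y * X) * real_diag n f * mat_adjoint (Y * X)"
      unfolding S using X(1,2) by (simp add: assoc adj)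
    then show ?thesis using X by simp
  qed
  have "char_poly S = char_poly (real_diag n e)"
    using V Sc SV by (intro char_poly_similar similar_matI[of _ _ V "mat_adjoint V" n]) auto
  then have "pos_eigenvalue_count S = card {j. j < n \<and> e j > 0}"
    by (simp add: pos_eigenvalue_count_real_diag[symmetric] pos_eigenvalue_count_def)
  moreover have "real_diag n e = (mat_adjoint V * X) * real_diag n f * mat_adjoint (mat_adjoint V * X)"
    unfolding VSV unfolding S using X(1) V(1) by (simp add: assoc adj)
  then have "card {j. j < n \<and> e j > 0} \<le> card {j. j < n \<and> f j > 0}"
    using X V by (intro inertia_le[of "mat_adjoint V * X"]) auto
  moreover have "real_diag n f = (Y * V) * real_diag n e * mat_adjoint (Y * V)"
    unfolding YSY SV using X(2) V(1) by (simp add: assoc adj)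
  then have "card {j. j < n \<and> f j > 0} \<le> card {j. j < n \<and> e j > 0}"
    using X V by (intro inertia_le[of "Y * V"]) auto
  ultimately show ?thesis by simp
qed

section \<open>Maximal isotropic boundary conditions\<close>

lemma smult_mat_mult_vec:
  fixes M :: "'a :: comm_ring_1 mat"
  assumes "M \<in> carrier_mat m n" "v \<in> carrier_vec n"
  shows "(c \<cdot>\<^sub>m M) *\<^sub>v v = c \<cdot>\<^sub>v (M *\<^sub>v v)"
  using assms by (intro eq_vecI) (auto simp: scalar_prod_def sum_distrib_left mult_ac)

lemma mult_mat_zero_vec:
  fixes M :: "'a :: comm_ring_1 mat"
  assumes "M \<in> carrier_mat m n"
  shows "M *\<^sub>v 0\<^sub>v n = 0\<^sub>v m"
  using assms by (intro eq_vecI) auto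

text \<open>Rank n means that some of the columns form a basis. The product here is bilinear, so it
  is the conjugate of x that is expanded in this basis, which makes the squared norm of x a
  combination of the given zeros.\<close>

lemma full_row_rank_orthogonal:
  fixes M :: "complex mat"
  assumes M: "M \<in> carrier_mat n m" and rank: "vec_space.rank n M = n"
    and x: "x \<in> carrier_vec n" and orth: "\<And>j. j < m \<Longrightarrow> x \<bullet> col M j = 0"
  shows "x = 0\<^sub>v n"
proof -
  interpret vec_space "TYPE(complex)" n .
  have sub: "set (cols M) \<subseteq> carrier_vec n" using M cols_dim by blast
  obtain S where "finite S" and mx: "maximal S (\<lambda>T. T \<subseteq> set (cols M) \<and> lin_indpt T)"
  proof -
    have "\<exists>S. finite S \<and> maximal S (\<lambda>T. T \<subseteq> set (cols M) \<and> lin_indpt T)"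
    proof (rule maximal_exists[of _ "card (set (cols M))" "{}"])
      show "{} \<subseteq> set (cols M) \<and> lin_indpt {}" by (auto simp: lin_dep_def)
    qed (auto intro: card_mono rev_finite_subset)
    then show ?thesis using that by blast
  qed
  then have S: "S \<subseteq> set (cols M)" "lin_indpt S" "card S = n"
    using rank_card_indpt[OF M mx] rank by (auto simp: maximal_def)
  have Sc: "S \<subseteq> carrier_vec n" using S sub by blast
  have "basis S"
    using dim_li_is_basis[OF fin_dim \<open>finite S\<close>] Sc S by (simp add: dim_is_n)
  then have "span S = carrier_vec n" by (simp add: basis_def)
  then have "conjugate x \<in> span S" using x by simp
  then obtain c where c: "conjugate x = lincomb c S"
    using finite_in_span[OF \<open>finite S\<close>] Sc by (metis module_vec_simps(3))
  have "x \<bullet>c x = (\<Sum>i<n. x $ i * (\<Sum>v\<in>S. c v * v $ i))"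
    unfolding c using x Sc \<open>finite S\<close>
    by (simp add: scalar_prod_def lessThan_atLeast0 lincomb_index lincomb_dim)
  also have "\<dots> = (\<Sum>v\<in>S. c v * (x \<bullet> v))"
  proof -
    have "(\<Sum>i<n. x $ i * (\<Sum>v\<in>S. c v * v $ i)) = (\<Sum>v\<in>S. \<Sum>i<n. x $ i * (c v * v $ i))"
      by (simp add: sum_distrib_left) (rule sum.swap)
    also have "\<dots> = (\<Sum>v\<in>S. c v * (x \<bullet> v))"
    proof (intro sum.cong refl)
      fix v assume "v \<in> S"
      then have "v \<in> carrier_vec n" using Sc by blast
      then show "(\<Sum>i<n. x $ i * (c v * v $ i)) = c v * (x \<bullet> v)"
        by (simp add: scalar_prod_def lessThan_atLeast0 sum_distrib_left mult_ac)
    qed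
    finally show ?thesis .
  qed
  also have "\<dots> = 0"
  proof (intro sum.neutral ballI)
    fix v assume "v \<in> S"
    then obtain j where "j < m" "v = col M j"
      using S(1) M by (force simp: cols_def)
    then show "c v * (x \<bullet> v) = 0" using orth by simp
  qed
  finally show ?thesis using x by simp
qed

lemma inverse_of_injective:
  fixes C :: "complex mat"
  assumes C: "C \<in> carrier_mat n n"
    and inj: "\<And>v. v \<in> carrier_vec n \<Longrightarrow> C *\<^sub>v v = 0\<^sub>v n \<Longrightarrow> v = 0\<^sub>v n"
  obtains D where "D \<in> carrier_mat n n" "D * C = 1\<^sub>m n" "C * D = 1\<^sub>m n"
proof -
  have "det C \<noteq> 0"
    using det_0_iff_vec_prod_zero[OF C] inj by auto
  from det_non_zero_imp_unit[OF C this, of "()"]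
  show thesis using that by (auto simp: Units_def ring_mat_simps)
qed

lemma cscalar_prod_mult_mat:
  fixes M :: "complex mat"
  assumes "M \<in> carrier_mat m n" "x \<in> carrier_vec n" "y \<in> carrier_vec m"
  shows "(M *\<^sub>v x) \<bullet>c y = x \<bullet>c (mat_adjoint M *\<^sub>v y)"
proof -
  have "(M *\<^sub>v x) \<bullet>c y = (\<Sum>i<m. \<Sum>j<n. M $$ (i, j) * x $ j * cnj (y $ i))"
    using assms by (simp add: scalar_prod_def lessThan_atLeast0 sum_distrib_right)
  also have "\<dots> = (\<Sum>j<n. \<Sum>i<m. M $$ (i, j) * x $ j * cnj (y $ i))"
    by (rule sum.swap)
  also have "\<dots> = x \<bullet>c (mat_adjoint M *\<^sub>v y)"
    using assms by (simp add: scalar_prod_def lessThan_atLeast0 sum_distrib_left mult_ac)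
  finally show ?thesis .
qed

section \<open>Decoupling the boundary condition\<close>

context
  fixes n :: nat and A B :: "complex mat"
  assumes iso: "max_isotropic_AB n A B"
begin

lemma AB_carrier: "A \<in> carrier_mat n n" "B \<in> carrier_mat n n"
  using iso by (auto simp: max_isotropic_AB_def)

lemma AB_adjoint: "B * mat_adjoint A = A * mat_adjoint B"
  using iso AB_carrier by (auto simp: max_isotropic_AB_def mat_adjoint_mult[of _ n n _ n])

text \<open>The rank condition says that (A, B) is onto, and the adjoint of an onto map is
  injective.\<close>

lemma adjoint_kernels_trivial:
  assumes x: "x \<in> carrier_vec n" and Ax: "mat_adjoint A *\<^sub>v x = 0\<^sub>v n"
    and Bx: "mat_adjoint B *\<^sub>v x = 0\<^sub>v n"
  shows "x = 0\<^sub>v n"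
proof -
  let ?M = "mat_of_cols n (cols A @ cols B)"
  have M: "?M \<in> carrier_mat n (n + n)" using AB_carrier by (auto simp: mat_of_cols_def)
  have colM: "col ?M j = (if j < n then col A j else col B (j - n))" if "j < n + n" for j
    using that AB_carrier by (subst col_mat_of_cols) (auto simp: nth_append)
  have orth: "col X j \<bullet>c x = 0"
    if X: "X \<in> carrier_mat n n" "mat_adjoint X *\<^sub>v x = 0\<^sub>v n" and j: "j < n" for X j
  proof -
    have "cnj (col X j \<bullet>c x) = (mat_adjoint X *\<^sub>v x) $ j"
      using X(1) x j by (simp add: scalar_prod_def mult_ac)
    then show ?thesis using X(2) j by simp
  qed
  have "conjugate x = 0\<^sub>v n"
  proof (rule full_row_rank_orthogonal[OF M])
    show "vec_space.rank n ?M = n" using iso by (simp add: max_isotropic_AB_def)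
    show "conjugate x \<in> carrier_vec n" using x by simp
    fix j assume j: "j < n + n"
    have "col ?M j \<bullet>c x = 0"
      using colM[OF j] orth[OF AB_carrier(1) Ax, of j] orth[OF AB_carrier(2) Bx, of "j - n"] j by auto
    then show "conjugate x \<bullet> col ?M j = 0"
      using x M by (metis carrier_vec_conjugate col_dim carrier_matD(1) comm_scalar_prod)
  qed
  then show ?thesis using x by simp
qed

text \<open>Some invertible combination is needed before eigenvalues can be used to find a real one.
  For x in the kernel of the adjoint, u = A^dagger x and w = B^dagger x satisfy w = - i u, while
  hermiticity of A B^dagger makes the products of u with w and of w with u agree. These are i and -
  i times the squared norm of u, so u = w = 0.\<close>

lemma invertible_shift:
  obtains D where "D \<in> carrier_mat n n" "D * (B + (- \<i>) \<cdot>\<^sub>m A) = 1\<^sub>m n"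
    "(B + (- \<i>) \<cdot>\<^sub>m A) * D = 1\<^sub>m n"
proof -
  let ?Z = "B + (- \<i>) \<cdot>\<^sub>m A"
  have Z: "?Z \<in> carrier_mat n n" using AB_carrier by auto
  have adjZ: "mat_adjoint ?Z = mat_adjoint B + \<i> \<cdot>\<^sub>m mat_adjoint A"
    using AB_carrier by (subst mat_adjoint_add[of _ n n]) (auto simp: mat_adjoint_smult)
  obtain E where E: "E \<in> carrier_mat n n" "E * mat_adjoint ?Z = 1\<^sub>m n" "mat_adjoint ?Z * E = 1\<^sub>m n"
  proof (rule inverse_of_injective[of "mat_adjoint ?Z" n])
    show "mat_adjoint ?Z \<in> carrier_mat n n" using Z by simp
  next
    fix x :: "complex vec"
    assume x: "x \<in> carrier_vec n" and 0: "mat_adjoint ?Z *\<^sub>v x = 0\<^sub>v n"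
    define u where "u = mat_adjoint A *\<^sub>v x"
    define w where "w = mat_adjoint B *\<^sub>v x"
    have uw: "u \<in> carrier_vec n" "w \<in> carrier_vec n"
      unfolding u_def w_def using AB_carrier x by (auto intro!: mult_mat_vec_carrier)
    have "w + \<i> \<cdot>\<^sub>v u = 0\<^sub>v n"
      using 0 AB_carrier x unfolding adjZ u_def w_def
      by (simp add: add_mult_distrib_mat_vec[of _ n n] smult_mat_mult_vec[of _ n n])
    then have w: "w $ i = - \<i> * u $ i" if "i < n" for i
    proof -
      have "(w + \<i> \<cdot>\<^sub>v u) $ i = 0" using \<open>w + \<i> \<cdot>\<^sub>v u = 0\<^sub>v n\<close> that by simp
      then show ?thesis using that uw by (simp add: add_eq_0_iff)
    qed
    have "u \<bullet>c w = x \<bullet>c (mat_adjoint (mat_adjoint A) *\<^sub>v w)"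
      unfolding u_def using AB_carrier x uw by (intro cscalar_prod_mult_mat[of _ n n]) auto
    also have "\<dots> = x \<bullet>c ((A * mat_adjoint B) *\<^sub>v x)"
      unfolding w_def using AB_carrier x by (simp add: assoc_mult_mat_vec[of _ n n _ n])
    also have "\<dots> = x \<bullet>c ((B * mat_adjoint A) *\<^sub>v x)"
      by (simp add: AB_adjoint)
    also have "\<dots> = x \<bullet>c (mat_adjoint (mat_adjoint B) *\<^sub>v u)"
      unfolding u_def using AB_carrier x by (simp add: assoc_mult_mat_vec[of _ n n _ n])
    also have "\<dots> = w \<bullet>c u"
      unfolding w_def using AB_carrier x uw by (intro cscalar_prod_mult_mat[of _ n n, symmetric]) auto
    finally have "u \<bullet>c w = w \<bullet>c u" .
    moreover have "u \<bullet>c w = \<i> * (u \<bullet>c u)"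
      using uw w by (simp add: scalar_prod_def sum_distrib_left mult_ac)
    moreover have "w \<bullet>c u = - \<i> * (u \<bullet>c u)"
      using uw w by (simp add: scalar_prod_def sum_distrib_left mult_ac sum_negf)
    ultimately have "u \<bullet>c u = 0" by simp
    then have u0: "u = 0\<^sub>v n" using uw by simp
    then have "w = 0\<^sub>v n" using uw w by (intro eq_vecI) auto
    with u0 show "x = 0\<^sub>v n"
      using adjoint_kernels_trivial[OF x] by (simp add: u_def w_def)
  qed (blast intro: that)
  have "mat_adjoint E * ?Z = mat_adjoint (mat_adjoint ?Z * E)"
    using E Z by (subst mat_adjoint_mult[of _ n n _ n]) auto
  moreover have "?Z * mat_adjoint E = mat_adjoint (E * mat_adjoint ?Z)"
    using E Z by (subst mat_adjoint_mult[of _ n n _ n]) auto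
  ultimately show thesis
    using E that[of "mat_adjoint E"] by simp
qed

text \<open>Only finitely many shifts can fail, because each of them makes
  -1/(t + i) an eigenvalue of the fixed matrix inv(B - i A) A.\<close>

lemma invertible_real_shift:
  obtains t :: real and D where "t > 0" "D \<in> carrier_mat n n"
    "D * (B + complex_of_real t \<cdot>\<^sub>m A) = 1\<^sub>m n" "(B + complex_of_real t \<cdot>\<^sub>m A) * D = 1\<^sub>m n"
proof -
  let ?Z = "B + (- \<i>) \<cdot>\<^sub>m A"
  have Z: "?Z \<in> carrier_mat n n" using AB_carrier by auto
  obtain E where E: "E \<in> carrier_mat n n" "E * ?Z = 1\<^sub>m n" "?Z * E = 1\<^sub>m n"
    using invertible_shift by blast
  define Y where "Y = E * A"
  have Y: "Y \<in> carrier_mat n n" using E AB_carrier by (auto simp: Y_def)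
  define \<phi> where "\<phi> t = - 1 / (complex_of_real t + \<i>)" for t
  have ti: "complex_of_real t + \<i> \<noteq> 0" for t by (simp add: complex_eq_iff)
  have "char_poly Y \<noteq> 0"
    using degree_monic_char_poly[OF Y] by auto
  then have fin: "finite {z. poly (char_poly Y) z = 0}" by (rule poly_roots_finite)
  have inj: "inj_on \<phi> {0<..}"
    using ti by (intro inj_onI) (auto simp: \<phi>_def field_simps)
  have "infinite (\<phi> ` {0<..})"
    using finite_image_iff[OF inj] infinite_Ioi by blast
  then obtain t where t: "t > 0" "poly (char_poly Y) (\<phi> t) \<noteq> 0"
    using fin by (metis (mono_tags, lifting) greaterThan_iff image_subset_iff infinite_super mem_Collect_eq)
  then have no_ev: "\<not> eigenvalue Y (\<phi> t)"
    using eigenvalue_root_char_poly[OF Y] by simp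
  let ?C = "B + complex_of_real t \<cdot>\<^sub>m A"
  have C: "?C \<in> carrier_mat n n" using AB_carrier by auto
  obtain D where "D \<in> carrier_mat n n" "D * ?C = 1\<^sub>m n" "?C * D = 1\<^sub>m n"
  proof (rule inverse_of_injective[OF C])
    fix v :: "complex vec"
    assume v: "v \<in> carrier_vec n" and 0: "?C *\<^sub>v v = 0\<^sub>v n"
    \<comment> \<open>With Z = B - i A one has B + t A = Z + (t + i) A. Applying the inverse E of Z
      turns a kernel vector v into a solution of v + (t + i) Y v = 0.\<close>
    have C_eq: "?C = ?Z + (complex_of_real t + \<i>) \<cdot>\<^sub>m A"
      using AB_carrier by (intro eq_matI) (auto simp: algebra_simps)
    have Ec: "E *\<^sub>v (?Z *\<^sub>v v) = v" "E *\<^sub>v (A *\<^sub>v v) = Y *\<^sub>v v"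
      using assoc_mult_mat_vec[OF E(1) Z v] assoc_mult_mat_vec[OF E(1) AB_carrier(1) v] E v
      by (simp_all add: Y_def)
    have "0\<^sub>v n = E *\<^sub>v (?C *\<^sub>v v)" unfolding 0 using E by (simp add: mult_mat_zero_vec[of _ n n])
    also have "?C *\<^sub>v v = ?Z *\<^sub>v v + (complex_of_real t + \<i>) \<cdot>\<^sub>v (A *\<^sub>v v)"
      unfolding C_eq using AB_carrier v
      by (subst add_mult_distrib_mat_vec[OF Z _ v]) (auto simp: smult_mat_mult_vec[of _ n n])
    also have "E *\<^sub>v \<dots> = v + (complex_of_real t + \<i>) \<cdot>\<^sub>v (Y *\<^sub>v v)"
      using E Z AB_carrier v Ec
      by (subst mult_add_distrib_mat_vec[of _ n n])
        (auto simp: mult_mat_vec[of _ n n] intro!: mult_mat_vec_carrier)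
    finally have eq: "v + (complex_of_real t + \<i>) \<cdot>\<^sub>v (Y *\<^sub>v v) = 0\<^sub>v n" by simp
    have "Y *\<^sub>v v = \<phi> t \<cdot>\<^sub>v v"
    proof (intro eq_vecI)
      fix i assume "i < dim_vec (\<phi> t \<cdot>\<^sub>v v)"
      then have i: "i < n" using v by simp
      have "v $ i + (complex_of_real t + \<i>) * (Y *\<^sub>v v) $ i = 0"
        using arg_cong[OF eq, of "\<lambda>v. v $ i"] i v Y by simp
      then have "(Y *\<^sub>v v) $ i = \<phi> t * v $ i"
        using ti[of t] by (simp add: \<phi>_def field_simps add_eq_0_iff)
      then show "(Y *\<^sub>v v) $ i = (\<phi> t \<cdot>\<^sub>v v) $ i" using i v by simp
    qed (use Y v in simp)
    then show "v = 0\<^sub>v n"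
      using no_ev v Y unfolding eigenvalue_def eigenvector_def by auto
  qed (blast intro: that)
  then show thesis using that t(1) by blast
qed

text \<open>Writing A = C L and B = C - t A, the condition becomes C (L (x - t x') + x') = 0, that
  is, x' = - L (x - t x'). The vector x - t x' is therefore a free parameter, and y holds its
  coordinates in the eigenbasis W of L.\<close>

theorem isotropic_normal_form:
  obtains W p q where "W \<in> carrier_mat n n" "mat_adjoint W * W = 1\<^sub>m n"
    "\<forall>y\<in>carrier_vec n.
       A *\<^sub>v (W *\<^sub>v (real_diag n p *\<^sub>v y)) + B *\<^sub>v (W *\<^sub>v (real_diag n q *\<^sub>v y)) = 0\<^sub>v n"
    "\<forall>x\<in>carrier_vec n. \<forall>x'\<in>carrier_vec n. A *\<^sub>v x + B *\<^sub>v x' = 0\<^sub>v n \<longrightarrow>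
       (\<exists>y\<in>carrier_vec n. x = W *\<^sub>v (real_diag n p *\<^sub>v y) \<and> x' = W *\<^sub>v (real_diag n q *\<^sub>v y))"
    "pos_eigenvalue_count (A * mat_adjoint B) = card {j. j < n \<and> p j * q j < 0}"
proof -
  note assoc = assoc_mult_mat[of _ n n _ n _ n] mult_carrier_mat[of _ n n _ n]
    and adj = mat_adjoint_mult[of _ n n _ n]
  note A = AB_carrier(1) and B = AB_carrier(2)
  obtain t D where t: "t > 0" and D: "D \<in> carrier_mat n n"
    and DC': "D * (B + complex_of_real t \<cdot>\<^sub>m A) = 1\<^sub>m n" "(B + complex_of_real t \<cdot>\<^sub>m A) * D = 1\<^sub>m n"
    using invertible_real_shift by blast
  define c where "c = complex_of_real t"
  define C where "C = B + c \<cdot>\<^sub>m A"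
  have C: "C \<in> carrier_mat n n" using A B by (simp add: C_def)
  have DC: "D * C = 1\<^sub>m n" "C * D = 1\<^sub>m n" using DC' by (simp_all add: C_def c_def)
  define L where "L = D * A"
  have L: "L \<in> carrier_mat n n" using D A by (simp add: L_def)
  have CL: "C * L = A"
  proof -
    have "C * L = (C * D) * A" unfolding L_def using C D A by (simp add: assoc)
    then show ?thesis using DC A by simp
  qed
  have adjC: "mat_adjoint C = mat_adjoint B + c \<cdot>\<^sub>m mat_adjoint A"
    unfolding C_def using A B by (subst mat_adjoint_add[of _ n n]) (auto simp: mat_adjoint_smult c_def)
  \<comment> \<open>This needs c to be real: the adjoint of C carries the conjugate of c.\<close>
  have ACCA: "A * mat_adjoint C = C * mat_adjoint A"
  proof -
    have "A * mat_adjoint C = A * mat_adjoint B + c \<cdot>\<^sub>m (A * mat_adjoint A)"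
      unfolding adjC using A B
      by (subst mult_add_distrib_mat[of _ n n _ n]) (auto simp: mult_smult_distrib[of _ n n _ n])
    also have "\<dots> = B * mat_adjoint A + c \<cdot>\<^sub>m (A * mat_adjoint A)"
      by (simp add: AB_adjoint)
    also have "\<dots> = C * mat_adjoint A"
      unfolding C_def using A B
      by (subst add_mult_distrib_mat[of _ n n _ _ n]) (auto simp: mult_smult_assoc_mat[of _ n n _ n])
    finally show ?thesis .
  qed
  have adjL: "mat_adjoint L = L"
  proof -
    have CD: "mat_adjoint C * mat_adjoint D = 1\<^sub>m n"
      using DC C D by (simp add: adj[symmetric])
    have "mat_adjoint L = (D * C) * (mat_adjoint A * mat_adjoint D)"
      using DC A D by (simp add: L_def adj assoc)
    also have "\<dots> = D * (C * mat_adjoint A) * mat_adjoint D"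
      using A C D by (simp add: assoc)
    also have "\<dots> = (D * A) * (mat_adjoint C * mat_adjoint D)"
      unfolding ACCA[symmetric] using A C D by (simp add: assoc)
    also have "\<dots> = L" using CD A D by (simp add: L_def)
    finally show ?thesis .
  qed
  obtain W d where W: "W \<in> carrier_mat n n" "mat_adjoint W * W = 1\<^sub>m n" "W * mat_adjoint W = 1\<^sub>m n"
    and LW: "L = W * real_diag n d * mat_adjoint W"
    using hermitian_diagonalization[OF L adjL] .
  define p where "p j = 1 - t * d j" for j
  define q where "q j = - d j" for j
  have mult_carrier [simp]: "M *\<^sub>v v \<in> carrier_vec n" if "M \<in> carrier_mat n n" for M :: "complex mat" and v
    using that by (intro carrier_vecI) simp
  have key: "A *\<^sub>v x + B *\<^sub>v x' = C *\<^sub>v (L *\<^sub>v (x + (- c) \<cdot>\<^sub>v x') + x')"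
    if x: "x \<in> carrier_vec n" "x' \<in> carrier_vec n" for x x'
  proof -
    have "C *\<^sub>v (L *\<^sub>v (x + (- c) \<cdot>\<^sub>v x') + x') = A *\<^sub>v (x + (- c) \<cdot>\<^sub>v x') + C *\<^sub>v x'"
      using A C L x
      by (simp add: mult_add_distrib_mat_vec[of _ n n] assoc_mult_mat_vec[of _ n n _ n, symmetric] CL)
    also have "A *\<^sub>v (x + (- c) \<cdot>\<^sub>v x') = A *\<^sub>v x + (- c) \<cdot>\<^sub>v (A *\<^sub>v x')"
      using A x by (simp add: mult_add_distrib_mat_vec[of _ n n] mult_mat_vec[of _ n n])
    also have "C *\<^sub>v x' = B *\<^sub>v x' + c \<cdot>\<^sub>v (A *\<^sub>v x')"
      unfolding C_def using A B x
      by (simp add: add_mult_distrib_mat_vec[of _ n n] smult_mat_mult_vec[of _ n n])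
    also have "A *\<^sub>v x + (- c) \<cdot>\<^sub>v (A *\<^sub>v x') + (B *\<^sub>v x' + c \<cdot>\<^sub>v (A *\<^sub>v x')) = A *\<^sub>v x + B *\<^sub>v x'"
      using A B x by (intro eq_vecI) auto
    finally show ?thesis by simp
  qed
  have LWy: "L *\<^sub>v (W *\<^sub>v y) = W *\<^sub>v (real_diag n d *\<^sub>v y)" if y: "y \<in> carrier_vec n" for y
  proof -
    have "L *\<^sub>v (W *\<^sub>v y) = (L * W) *\<^sub>v y"
      using L W y by (simp add: assoc_mult_mat_vec[of _ n n _ n])
    also have "L * W = W * real_diag n d * (mat_adjoint W * W)"
      unfolding LW using W(1) by (simp add: assoc)
    also have "\<dots> = W * real_diag n d" using W by simp
    finally show ?thesis using W y by (simp add: assoc_mult_mat_vec[of _ n n _ n])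
  qed
  have Qy: "W *\<^sub>v (real_diag n q *\<^sub>v y) = - (W *\<^sub>v (real_diag n d *\<^sub>v y))" if y: "y \<in> carrier_vec n" for y
  proof -
    have "real_diag n q *\<^sub>v y = (-1) \<cdot>\<^sub>v (real_diag n d *\<^sub>v y)"
      using y by (intro eq_vecI) (simp_all add: real_diag_mult_vec q_def)
    then show ?thesis using W y by (simp add: mult_mat_vec[of _ n n]) (auto intro!: eq_vecI)
  qed
  have Py: "W *\<^sub>v (real_diag n p *\<^sub>v y) = W *\<^sub>v y + c \<cdot>\<^sub>v (W *\<^sub>v (real_diag n q *\<^sub>v y))"
    if y: "y \<in> carrier_vec n" for y
  proof -
    have "real_diag n p *\<^sub>v y = y + c \<cdot>\<^sub>v (real_diag n q *\<^sub>v y)"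
      using y by (intro eq_vecI) (simp_all add: real_diag_mult_vec p_def q_def c_def algebra_simps)
    then show ?thesis
      using W y by (simp add: mult_add_distrib_mat_vec[of _ n n] mult_mat_vec[of _ n n])
  qed
  have 1: "A *\<^sub>v (W *\<^sub>v (real_diag n p *\<^sub>v y)) + B *\<^sub>v (W *\<^sub>v (real_diag n q *\<^sub>v y)) = 0\<^sub>v n"
    if y: "y \<in> carrier_vec n" for y
  proof -
    have "W *\<^sub>v (real_diag n p *\<^sub>v y) + (- c) \<cdot>\<^sub>v (W *\<^sub>v (real_diag n q *\<^sub>v y)) = W *\<^sub>v y"
      unfolding Py[OF y] using W by (intro eq_vecI) auto
    moreover have "L *\<^sub>v (W *\<^sub>v y) + W *\<^sub>v (real_diag n q *\<^sub>v y) = 0\<^sub>v n"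
      unfolding LWy[OF y] Qy[OF y] using W by (intro eq_vecI) auto
    ultimately show ?thesis
      using W C by (subst key) (simp_all add: mult_mat_zero_vec[of _ n n])
  qed
  have 2: "\<exists>y\<in>carrier_vec n. x = W *\<^sub>v (real_diag n p *\<^sub>v y) \<and> x' = W *\<^sub>v (real_diag n q *\<^sub>v y)"
    if x: "x \<in> carrier_vec n" "x' \<in> carrier_vec n" and 0: "A *\<^sub>v x + B *\<^sub>v x' = 0\<^sub>v n" for x x'
  proof -
    \<comment> \<open>The parameter is forced: since p_j - t q_j = 1, any admissible y has W y = x -
      t x'.\<close>
    define z where "z = x + (- c) \<cdot>\<^sub>v x'"
    define y where "y = mat_adjoint W *\<^sub>v z"
    have z: "z \<in> carrier_vec n" using x by (simp add: z_def)
    have y: "y \<in> carrier_vec n" using W by (simp add: y_def)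
    have Wy: "W *\<^sub>v y = z"
      using W z by (simp add: y_def assoc_mult_mat_vec[of _ n n _ n, symmetric])
    have "L *\<^sub>v z + x' = D *\<^sub>v (C *\<^sub>v (L *\<^sub>v z + x'))"
      using D C L x DC by (simp add: assoc_mult_mat_vec[of _ n n _ n, symmetric])
    also have "\<dots> = 0\<^sub>v n"
      unfolding z_def key[OF x, symmetric] 0 using D by (simp add: mult_mat_zero_vec[of _ n n])
    finally have Lz: "L *\<^sub>v z + x' = 0\<^sub>v n" .
    have x'_eq: "x' = W *\<^sub>v (real_diag n q *\<^sub>v y)"
    proof (intro eq_vecI)
      fix i assume "i < dim_vec (W *\<^sub>v (real_diag n q *\<^sub>v y))"
      then have i: "i < n" using W by simp
      have "(L *\<^sub>v z) $ i + x' $ i = 0"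
        using arg_cong[OF Lz, of "\<lambda>v. v $ i"] i x L by simp
      then show "x' $ i = (W *\<^sub>v (real_diag n q *\<^sub>v y)) $ i"
        unfolding Qy[OF y] LWy[OF y, symmetric] Wy using i L by (simp add: add_eq_0_iff)
    qed (use W x in simp)
    moreover have "x = W *\<^sub>v (real_diag n p *\<^sub>v y)"
      unfolding Py[OF y] x'_eq[symmetric] Wy using x by (intro eq_vecI) (auto simp: z_def)
    ultimately show ?thesis using y by blast
  qed
  have 3: "pos_eigenvalue_count (A * mat_adjoint B) = card {j. j < n \<and> p j * q j < 0}"
  proof -
    \<comment> \<open>f_j = - p_j q_j = d_j - t d_j^2, so these are the eigenvalues of L - t L^2.
      Expressing A and B^dagger through C and L shows A B^dagger = C (L - t L^2) C^dagger.\<close>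
    define f where "f j = - (p j * q j)" for j
    have F: "real_diag n f = real_diag n d + (- c) \<cdot>\<^sub>m (real_diag n d * real_diag n d)"
      unfolding real_diag_mult by (intro eq_matI) (auto simp: f_def p_def q_def c_def algebra_simps)
    have LL: "L * L = W * (real_diag n d * real_diag n d) * mat_adjoint W"
    proof -
      have "L * L = W * real_diag n d * (mat_adjoint W * W) * real_diag n d * mat_adjoint W"
        unfolding LW using W(1) by (simp add: assoc)
      then show ?thesis using W by (simp add: assoc)
    qed
    have WFW: "W * real_diag n f * mat_adjoint W = L + (- c) \<cdot>\<^sub>m (L * L)"
      unfolding F LL using W(1)
      by (simp add: mult_add_distrib_mat[of _ n n _ n] add_mult_distrib_mat[of _ n n _ _ n]
          mult_smult_distrib[of _ n n _ n] mult_smult_assoc_mat[of _ n n _ n] LW assoc)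
    have adjA: "mat_adjoint A = L * mat_adjoint C"
      using arg_cong[OF CL, of mat_adjoint] C L adjL by (simp add: adj)
    have adjB: "mat_adjoint B = mat_adjoint C + (- c) \<cdot>\<^sub>m mat_adjoint A"
      unfolding adjC using A B by (intro eq_matI) auto
    have "A * mat_adjoint B = A * mat_adjoint C + (- c) \<cdot>\<^sub>m (A * mat_adjoint A)"
      unfolding adjB using A C
      by (simp add: mult_add_distrib_mat[of _ n n _ n] mult_smult_distrib[of _ n n _ n])
    also have "\<dots> = C * L * mat_adjoint C + (- c) \<cdot>\<^sub>m (C * L * (L * mat_adjoint C))"
      by (simp add: CL adjA)
    also have "\<dots> = C * (L + (- c) \<cdot>\<^sub>m (L * L)) * mat_adjoint C"
      using C L
      by (simp add: mult_add_distrib_mat[of _ n n _ n] add_mult_distrib_mat[of _ n n _ _ n]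
          mult_smult_distrib[of _ n n _ n] mult_smult_assoc_mat[of _ n n _ n] assoc)
    also have "\<dots> = (C * W) * real_diag n f * mat_adjoint (C * W)"
      unfolding WFW[symmetric] using C W(1) by (simp add: adj assoc)
    finally have S: "A * mat_adjoint B = (C * W) * real_diag n f * mat_adjoint (C * W)" .
    have "(mat_adjoint W * D) * (C * W) = mat_adjoint W * (D * C) * W"
      using C D W(1) by (simp add: assoc)
    then have inv: "(mat_adjoint W * D) * (C * W) = 1\<^sub>m n" using DC W by simp
    show ?thesis
      using sylvester_inertia[OF _ _ inv S] C D W by (simp add: f_def assoc)
  qed
  show thesis by (rule that[OF W(1,2) _ _ 3]) (use 1 2 in blast)+
qed

end

section \<open>Eigenfunctions on an edge\<close>

text \<open>Both exponentials are kept in one function because differentiation then only changes the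
  coefficients, from (alpha, beta) to (kappa alpha, - kappa beta).\<close>

definition expsol :: "complex \<Rightarrow> complex \<Rightarrow> real \<Rightarrow> real \<Rightarrow> complex" where
  "expsol \<alpha> \<beta> \<kappa> x = \<alpha> * complex_of_real (exp (\<kappa> * x)) + \<beta> * complex_of_real (exp (- \<kappa> * x))"

lemma expsol_derivative:
  "(expsol \<alpha> \<beta> \<kappa> has_vector_derivative expsol (\<kappa> * \<alpha>) (- (\<kappa> * \<beta>)) \<kappa> x) (at x within S)"
  unfolding expsol_def
  by (auto intro!: derivative_eq_intros simp: has_real_derivative_iff_has_vector_derivative[symmetric]
      algebra_simps)

lemma expsol_continuous [continuous_intros]: "continuous_on S (expsol \<alpha> \<beta> \<kappa>)"
  unfolding expsol_def by (intro continuous_intros)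

text \<open>Factoring the second order operator gives two first integrals, so f and g are found by
  solving two linear equations. The equation holds only almost everywhere, but under the integral h
  may be replaced by the continuous kappa^2 f, after which g is differentiable everywhere.\<close>

lemma ode_explicit_solution:
  assumes S: "\<And>x. x \<in> S \<Longrightarrow> 0 \<le> x \<and> {0..x} \<subseteq> S" and \<kappa>: "\<kappa> \<noteq> 0"
    and f: "abs_cont_with_deriv S f g" and g: "abs_cont_with_deriv S g h"
    and ev: "negligible {x \<in> S. - h x \<noteq> complex_of_real (- (\<kappa>\<^sup>2)) * f x}"
  obtains \<alpha> \<beta> where "\<And>x. x \<in> S \<Longrightarrow> f x = expsol \<alpha> \<beta> \<kappa> x"
    "\<And>x. x \<in> S \<Longrightarrow> g x = expsol (\<kappa> * \<alpha>) (- (\<kappa> * \<beta>)) \<kappa> x"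
proof -
  \<comment> \<open>Since f' = g and g' = kappa^2 f, the combination g - kappa f is a multiple of
    exp(- kappa x) and g + kappa f one of exp(kappa x); u and w are these constant
    multiples.\<close>
  define u where "u x = (g x - \<kappa> * f x) * complex_of_real (exp (\<kappa> * x))" for x
  define w where "w x = (g x + \<kappa> * f x) * complex_of_real (exp (- \<kappa> * x))" for x
  have uw: "u t = u 0 \<and> w t = w 0" if t: "t \<in> S" for t
  proof (cases "t = 0")
    case False
    with S[OF t] have t0: "t > 0" and sub: "{0..t} \<subseteq> S" by auto
    have "h integrable_on {0..t}" "g integrable_on {0..t}"
      using f g t by (auto simp: abs_cont_with_deriv_def dest!: set_lebesgue_integral_eq_integral(1))
    note cont = this[THEN indefinite_integral_continuous_1]
    have f_eq: "f x = f 0 + integral {0..x} g" and g_eq: "g x = g 0 + integral {0..x} h"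
      if "x \<in> {0..t}" for x
      using f g sub that unfolding abs_cont_with_deriv_def by blast+
    have contg: "continuous_on {0..t} g"
      using cont(1) by (subst continuous_on_cong[OF refl g_eq]) (auto intro!: continuous_intros)
    have contf: "continuous_on {0..t} f"
      using cont(2) by (subst continuous_on_cong[OF refl f_eq]) (auto intro!: continuous_intros)
    have g_eq': "g x = g 0 + integral {0..x} (\<lambda>x. complex_of_real (\<kappa>\<^sup>2) * f x)" if x: "x \<in> {0..t}" for x
    proof -
      have "integral {0..x} h = integral {0..x} (\<lambda>x. complex_of_real (\<kappa>\<^sup>2) * f x)"
      proof (rule integral_spike[OF ev])
        fix y assume "y \<in> {0..x} - {x \<in> S. - h x \<noteq> complex_of_real (- (\<kappa>\<^sup>2)) * f x}"
        moreover from this have "y \<in> S" using x by (intro subsetD[OF sub]) auto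
        ultimately have "- h y = complex_of_real (- (\<kappa>\<^sup>2)) * f y" by auto
        then show "complex_of_real (\<kappa>\<^sup>2) * f y = h y" by (simp add: minus_equation_iff)
      qed
      then show ?thesis using g_eq[OF x] by simp
    qed
    have df: "(f has_vector_derivative g x) (at x within {0..t})" if x: "x \<in> {0..t}" for x
    proof -
      have "((\<lambda>x. f 0 + integral {0..x} g) has_vector_derivative g x) (at x within {0..t})"
        using integral_has_vector_derivative[OF contg x] by (auto intro!: derivative_eq_intros)
      then show ?thesis
        by (rule has_vector_derivative_transform[OF x, rotated]) (rule f_eq)
    qed
    have dg: "(g has_vector_derivative (complex_of_real (\<kappa>\<^sup>2) * f x)) (at x within {0..t})"
      if x: "x \<in> {0..t}" for x
    proof -
      have "continuous_on {0..t} (\<lambda>x. complex_of_real (\<kappa>\<^sup>2) * f x)"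
        using contf by (intro continuous_intros)
      from has_vector_derivative_add[OF has_vector_derivative_const integral_has_vector_derivative[OF this x]]
      have "((\<lambda>x. g 0 + integral {0..x} (\<lambda>x. complex_of_real (\<kappa>\<^sup>2) * f x)) has_vector_derivative
          complex_of_real (\<kappa>\<^sup>2) * f x) (at x within {0..t})"
        unfolding add_0_left .
      then show ?thesis
        by (rule has_vector_derivative_transform[OF x, rotated]) (rule g_eq')
    qed
    have e: "((\<lambda>x. complex_of_real (exp (c * x))) has_vector_derivative
        complex_of_real (c * exp (c * x))) (at x within {0..t})" for c x
      by (auto intro!: derivative_eq_intros simp: has_real_derivative_iff_has_vector_derivative[symmetric])
    have "(u has_vector_derivative 0) (at x within {0..t})" if x: "x \<in> {0..t}" for x
      unfolding u_def
      by (rule derivative_eq_intros df[OF x] dg[OF x] e refl)+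
        (simp add: algebra_simps power2_eq_square)
    moreover have "(w has_vector_derivative 0) (at x within {0..t})" if x: "x \<in> {0..t}" for x
      unfolding w_def
      by (rule derivative_eq_intros df[OF x] dg[OF x] e refl)+
        (simp add: algebra_simps power2_eq_square)
    ultimately obtain cu cw where "\<And>x. x \<in> {0..t} \<Longrightarrow> u x = cu" "\<And>x. x \<in> {0..t} \<Longrightarrow> w x = cw"
      by (metis convex_real_interval(5) has_vector_derivative_zero_constant)
    then show ?thesis using t0 by simp
  qed auto
  have e1: "complex_of_real (exp (\<kappa> * x)) * complex_of_real (exp (- \<kappa> * x)) = 1" for x
    by (simp add: of_real_mult[symmetric] exp_minus del: of_real_mult)
  have fg: "g x - \<kappa> * f x = u 0 * complex_of_real (exp (- \<kappa> * x))"
    "g x + \<kappa> * f x = w 0 * complex_of_real (exp (\<kappa> * x))" if "x \<in> S" for x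
    using uw[OF that] e1[of x] by (metis mult.assoc mult.commute mult_1 u_def w_def)+
  define \<alpha> where "\<alpha> = w 0 / (2 * \<kappa>)"
  define \<beta> where "\<beta> = - u 0 / (2 * \<kappa>)"
  have "f x = expsol \<alpha> \<beta> \<kappa> x" if "x \<in> S" for x
  proof -
    have "2 * \<kappa> * f x = (g x + \<kappa> * f x) - (g x - \<kappa> * f x)" by simp
    also have "\<dots> = 2 * \<kappa> * expsol \<alpha> \<beta> \<kappa> x"
      unfolding fg[OF that] using \<kappa> by (simp add: expsol_def \<alpha>_def \<beta>_def field_simps)
    finally show ?thesis using \<kappa> by simp
  qed
  moreover have "g x = expsol (\<kappa> * \<alpha>) (- (\<kappa> * \<beta>)) \<kappa> x" if "x \<in> S" for x
  proof -
    have "2 * g x = (g x + \<kappa> * f x) + (g x - \<kappa> * f x)" by simp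
    also have "\<dots> = 2 * expsol (\<kappa> * \<alpha>) (- (\<kappa> * \<beta>)) \<kappa> x"
      unfolding fg[OF that] using \<kappa> by (simp add: expsol_def \<alpha>_def \<beta>_def field_simps)
    finally show ?thesis by simp
  qed
  ultimately show thesis using that by blast
qed

text \<open>A growing term keeps the modulus at least 1 beyond some X, so the integral would exceed
  the length r of every interval from X to X + r.\<close>

lemma square_integrable_expsol_half_line:
  assumes \<kappa>: "\<kappa> > 0" and int: "(\<lambda>x. (cmod (expsol \<alpha> \<beta> \<kappa> x))\<^sup>2) integrable_on {0..}"
  shows "\<alpha> = 0"
proof (rule ccontr)
  assume \<alpha>: "\<alpha> \<noteq> 0"
  \<comment> \<open>Chosen so that |alpha| kappa X = |beta| + 1; with exp(kappa x) >= kappa x the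
    growing term exceeds the other by at least 1.\<close>
  define X where "X = (cmod \<beta> + 1) / (cmod \<alpha> * \<kappa>)"
  have X: "X > 0" using \<alpha> \<kappa> by (auto simp: X_def intro!: divide_pos_pos add_nonneg_pos)
  have large: "1 \<le> (cmod (expsol \<alpha> \<beta> \<kappa> x))\<^sup>2" if "x \<ge> X" for x
  proof -
    have "cmod \<beta> + 1 = cmod \<alpha> * (\<kappa> * X)" using \<alpha> \<kappa> by (simp add: X_def)
    also have "\<dots> \<le> cmod \<alpha> * exp (\<kappa> * x)"
    proof (intro mult_left_mono)
      have "\<kappa> * X \<le> \<kappa> * x" using that \<kappa> by simp
      also have "\<dots> \<le> exp (\<kappa> * x)" using exp_ge_add_one_self[of "\<kappa> * x"] by linarith
      finally show "\<kappa> * X \<le> exp (\<kappa> * x)" .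
    qed simp
    finally have 1: "cmod \<beta> + 1 \<le> cmod (\<alpha> * complex_of_real (exp (\<kappa> * x)))"
      by (simp add: norm_mult)
    have "cmod (\<beta> * complex_of_real (exp (- \<kappa> * x))) \<le> cmod \<beta>"
      using that X \<kappa> by (auto simp: norm_mult intro!: mult_left_le)
    then have "1 \<le> cmod (expsol \<alpha> \<beta> \<kappa> x)"
      using 1 norm_diff_ineq[of "\<alpha> * complex_of_real (exp (\<kappa> * x))" "\<beta> * complex_of_real (exp (- \<kappa> * x))"]
      unfolding expsol_def by linarith
    then show ?thesis by (simp add: power2_eq_square mult_ge1_I)
  qed
  define I where "I = integral {0..} (\<lambda>x. (cmod (expsol \<alpha> \<beta> \<kappa> x))\<^sup>2)"
  have "r \<le> I" if "r > 0" for r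
  proof -
    have sub: "{X..X + r} \<subseteq> {0..}" using X by auto
    have int': "(\<lambda>x. (cmod (expsol \<alpha> \<beta> \<kappa> x))\<^sup>2) integrable_on {X..X + r}"
      by (intro integrable_continuous_real continuous_intros)
    have "r = integral {X..X + r} (\<lambda>_. 1)" using that by simp
    also have "\<dots> \<le> integral {X..X + r} (\<lambda>x. (cmod (expsol \<alpha> \<beta> \<kappa> x))\<^sup>2)"
      using large by (intro integral_le int') auto
    also have "\<dots> \<le> I"
      unfolding I_def by (intro integral_subset_le sub int' int) auto
    finally show ?thesis .
  qed
  from this[of "\<bar>I\<bar> + 1"] show False by linarith
qed

section \<open>Green's identity on one edge\<close>

text \<open>Integrate the derivative of cnj f times g', using g'' = mu^2 g. The rates kappa and mu
  may differ, as eigenfunctions of different eigenvalues will be paired.\<close>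

lemma green_interval:
  fixes b \<kappa> \<mu> :: real and \<alpha> \<beta> \<gamma> \<delta> :: complex
  assumes "b \<ge> 0"
  defines "f \<equiv> expsol \<alpha> \<beta> \<kappa>" and "f' \<equiv> expsol (\<kappa> * \<alpha>) (- (\<kappa> * \<beta>)) \<kappa>"
    and "g \<equiv> expsol \<gamma> \<delta> \<mu>" and "g' \<equiv> expsol (\<mu> * \<gamma>) (- (\<mu> * \<delta>)) \<mu>"
  shows "(\<lambda>x. cnj (f x) * g x) integrable_on {0..b}" "(\<lambda>x. cnj (f' x) * g' x) integrable_on {0..b}"
    "complex_of_real (\<mu>\<^sup>2) * integral {0..b} (\<lambda>x. cnj (f x) * g x) + integral {0..b} (\<lambda>x. cnj (f' x) * g' x)
      = cnj (f b) * g' b - cnj (f 0) * g' 0"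
proof -
  show 1: "(\<lambda>x. cnj (f x) * g x) integrable_on {0..b}" "(\<lambda>x. cnj (f' x) * g' x) integrable_on {0..b}"
    unfolding f_def g_def f'_def g'_def
    by (intro integrable_continuous_real continuous_intros)+
  have df: "(f has_vector_derivative f' x) (at x within {0..b})" for x
    unfolding f_def f'_def by (rule expsol_derivative)
  have g2: "expsol (\<mu> * (\<mu> * \<gamma>)) (- (\<mu> * - (\<mu> * \<delta>))) \<mu> x = complex_of_real (\<mu>\<^sup>2) * g x" for x
    by (simp add: g_def expsol_def algebra_simps power2_eq_square)
  have dg': "(g' has_vector_derivative (complex_of_real (\<mu>\<^sup>2) * g x)) (at x within {0..b})" for x
    unfolding g'_def g2[symmetric] using expsol_derivative[of "\<mu> * \<gamma>" "- (\<mu> * \<delta>)" \<mu> x "{0..b}"] by simp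
  have "((\<lambda>x. cnj (f x) * (complex_of_real (\<mu>\<^sup>2) * g x) + cnj (f' x) * g' x) has_integral
      cnj (f b) * g' b - cnj (f 0) * g' 0) {0..b}"
    by (intro fundamental_theorem_of_calculus assms(1) derivative_intros df dg')
  moreover have "((\<lambda>x. complex_of_real (\<mu>\<^sup>2) * (cnj (f x) * g x) + cnj (f' x) * g' x) has_integral
      complex_of_real (\<mu>\<^sup>2) * integral {0..b} (\<lambda>x. cnj (f x) * g x) + integral {0..b} (\<lambda>x. cnj (f' x) * g' x)) {0..b}"
    by (intro has_integral_add has_integral_mult_right integrable_integral 1)
  ultimately show "complex_of_real (\<mu>\<^sup>2) * integral {0..b} (\<lambda>x. cnj (f x) * g x)
      + integral {0..b} (\<lambda>x. cnj (f' x) * g' x) = cnj (f b) * g' b - cnj (f 0) * g' 0"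
    by (intro has_integral_unique) (simp_all add: mult_ac)
qed

lemma has_integral_expsol_half_line:
  assumes "\<kappa> > 0" "\<mu> > 0"
  shows "((\<lambda>x. cnj (expsol 0 \<beta> \<kappa> x) * expsol 0 \<delta> \<mu> x) has_integral
    cnj \<beta> * \<delta> / complex_of_real (\<kappa> + \<mu>)) {0..}"
proof -
  have "((\<lambda>x. exp (- (\<kappa> + \<mu>) * x)) has_integral 1 / (\<kappa> + \<mu>)) {0..}"
    using has_integral_exp_minus_to_infinity[of "\<kappa> + \<mu>" 0] assms by simp
  from has_integral_mult_right[OF has_integral_of_real[OF this], of "cnj \<beta> * \<delta>"]
  have "((\<lambda>x. cnj \<beta> * \<delta> * complex_of_real (exp (- (\<kappa> + \<mu>) * x))) has_integral
      cnj \<beta> * \<delta> * complex_of_real (1 / (\<kappa> + \<mu>))) {0..}" .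
  moreover have "cnj (expsol 0 \<beta> \<kappa> x) * expsol 0 \<delta> \<mu> x
      = cnj \<beta> * \<delta> * complex_of_real (exp (- (\<kappa> + \<mu>) * x))" for x
  proof -
    have "exp (- (\<kappa> + \<mu>) * x) = exp (- \<kappa> * x) * exp (- \<mu> * x)"
      by (simp add: exp_add[symmetric] algebra_simps)
    then show ?thesis by (simp add: expsol_def)
  qed
  ultimately show ?thesis by simp
qed

text \<open>Explicit integrals replace a limit at infinity: both are multiples of 1 / (kappa + mu),
  and (mu^2 + kappa mu) / (kappa + mu) = mu is the boundary term at 0.\<close>

lemma green_half_line:
  fixes \<kappa> \<mu> :: real and \<beta> \<delta> :: complex
  assumes "\<kappa> > 0" "\<mu> > 0"
  defines "f \<equiv> expsol 0 \<beta> \<kappa>" and "f' \<equiv> expsol 0 (- (\<kappa> * \<beta>)) \<kappa>"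
    and "g \<equiv> expsol 0 \<delta> \<mu>" and "g' \<equiv> expsol 0 (- (\<mu> * \<delta>)) \<mu>"
  shows "(\<lambda>x. cnj (f x) * g x) integrable_on {0..}" "(\<lambda>x. cnj (f' x) * g' x) integrable_on {0..}"
    "complex_of_real (\<mu>\<^sup>2) * integral {0..} (\<lambda>x. cnj (f x) * g x) + integral {0..} (\<lambda>x. cnj (f' x) * g' x)
      = - (cnj (f 0) * g' 0)"
proof -
  note 1 = has_integral_expsol_half_line[OF assms(1,2), of \<beta> \<delta>]
    and 2 = has_integral_expsol_half_line[OF assms(1,2), of "- (\<kappa> * \<beta>)" "- (\<mu> * \<delta>)"]
  show "(\<lambda>x. cnj (f x) * g x) integrable_on {0..}" "(\<lambda>x. cnj (f' x) * g' x) integrable_on {0..}"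
    unfolding f_def g_def f'_def g'_def using 1 2 by (auto simp only: integrable_on_def)
  have "complex_of_real (\<kappa> + \<mu>) \<noteq> 0"
    using assms(1,2) by (simp only: of_real_eq_0_iff)
  then have "complex_of_real (\<mu>\<^sup>2) * (cnj \<beta> * \<delta> / complex_of_real (\<kappa> + \<mu>))
      + cnj (- (\<kappa> * \<beta>)) * (- (\<mu> * \<delta>)) / complex_of_real (\<kappa> + \<mu>) = \<mu> * (cnj \<beta> * \<delta>)"
    by (simp add: add_divide_distrib[symmetric] nonzero_divide_eq_eq) (simp add: algebra_simps power2_eq_square)
  then show "complex_of_real (\<mu>\<^sup>2) * integral {0..} (\<lambda>x. cnj (f x) * g x)
      + integral {0..} (\<lambda>x. cnj (f' x) * g' x) = - (cnj (f 0) * g' 0)"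
    unfolding f_def g_def f'_def g'_def integral_unique[OF 1] integral_unique[OF 2]
    by (simp add: expsol_def)
qed

text \<open>The source of all positivity: the hermitian form of a Gram matrix is the squared norm of
  the combined function.\<close>

lemma integral_gram:
  fixes \<phi> :: "'k \<Rightarrow> real \<Rightarrow> complex"
  assumes "finite K" and int: "\<And>k l. k \<in> K \<Longrightarrow> l \<in> K \<Longrightarrow> (\<lambda>x. cnj (\<phi> k x) * \<phi> l x) integrable_on S"
  shows "(\<lambda>x. (cmod (\<Sum>k\<in>K. c k * \<phi> k x))\<^sup>2) integrable_on S"
    "(\<Sum>k\<in>K. \<Sum>l\<in>K. cnj (c k) * c l * integral S (\<lambda>x. cnj (\<phi> k x) * \<phi> l x))
      = complex_of_real (integral S (\<lambda>x. (cmod (\<Sum>k\<in>K. c k * \<phi> k x))\<^sup>2))"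
proof -
  have sq: "complex_of_real ((cmod (\<Sum>k\<in>K. c k * \<phi> k x))\<^sup>2)
      = (\<Sum>k\<in>K. \<Sum>l\<in>K. cnj (c k) * c l * (cnj (\<phi> k x) * \<phi> l x))" for x
  proof -
    have "complex_of_real ((cmod (\<Sum>k\<in>K. c k * \<phi> k x))\<^sup>2)
        = (\<Sum>k\<in>K. cnj (c k) * cnj (\<phi> k x)) * (\<Sum>l\<in>K. c l * \<phi> l x)"
      by (simp add: complex_norm_square mult.commute del: of_real_power)
    then show ?thesis by (simp only: sum_product) (simp add: mult_ac)
  qed
  have "((\<lambda>x. \<Sum>k\<in>K. \<Sum>l\<in>K. cnj (c k) * c l * (cnj (\<phi> k x) * \<phi> l x)) has_integral
      (\<Sum>k\<in>K. \<Sum>l\<in>K. cnj (c k) * c l * integral S (\<lambda>x. cnj (\<phi> k x) * \<phi> l x))) S"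
    using assms by (intro has_integral_sum has_integral_mult_right integrable_integral) auto
  then have 1: "((\<lambda>x. complex_of_real ((cmod (\<Sum>k\<in>K. c k * \<phi> k x))\<^sup>2)) has_integral
      (\<Sum>k\<in>K. \<Sum>l\<in>K. cnj (c k) * c l * integral S (\<lambda>x. cnj (\<phi> k x) * \<phi> l x))) S"
    unfolding sq .
  from has_integral_linear[OF 1 bounded_linear_Re]
  show 2: "(\<lambda>x. (cmod (\<Sum>k\<in>K. c k * \<phi> k x))\<^sup>2) integrable_on S"
    by (auto simp: o_def integrable_on_def)
  from has_integral_of_real[OF integrable_integral[OF this], where 'b = complex]
  show "(\<Sum>k\<in>K. \<Sum>l\<in>K. cnj (c k) * c l * integral S (\<lambda>x. cnj (\<phi> k x) * \<phi> l x))
      = complex_of_real (integral S (\<lambda>x. (cmod (\<Sum>k\<in>K. c k * \<phi> k x))\<^sup>2))"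
    using 1 by (rule has_integral_unique[symmetric])
qed

section \<open>The boundary form on eigenfunctions\<close>

definition edge_sol ::
  "nat \<Rightarrow> (nat \<Rightarrow> real) \<Rightarrow> nat \<Rightarrow> real \<Rightarrow> (real \<Rightarrow> complex) \<Rightarrow> (real \<Rightarrow> complex) \<Rightarrow> bool" where
  "edge_sol nE a j \<kappa> f f' \<longleftrightarrow> (\<exists>\<alpha> \<beta>. (j < nE \<longrightarrow> \<alpha> = 0) \<and>
     (\<forall>x\<in>edge_interval nE a j. f x = expsol \<alpha> \<beta> \<kappa> x \<and> f' x = expsol (\<kappa> * \<alpha>) (- (\<kappa> * \<beta>)) \<kappa> x))"

text \<open>Both kinds of edges in one formula: only an internal edge has a far endpoint that
  contributes.\<close>

lemma edge_green:
  fixes \<kappa> \<mu> :: real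
  assumes f: "edge_sol nE a j \<kappa> f f'" and g: "edge_sol nE a j \<mu> g g'"
    and pos: "\<kappa> > 0" "\<mu> > 0" "j \<ge> nE \<Longrightarrow> a (j - nE) > 0"
  defines "S \<equiv> edge_interval nE a j"
  shows "(\<lambda>x. cnj (f x) * g x) integrable_on S" "(\<lambda>x. cnj (f' x) * g' x) integrable_on S"
    "complex_of_real (\<mu>\<^sup>2) * integral S (\<lambda>x. cnj (f x) * g x) + integral S (\<lambda>x. cnj (f' x) * g' x)
      = (if j < nE then 0 else cnj (f (a (j - nE))) * g' (a (j - nE))) - cnj (f 0) * g' 0"
proof -
  from f obtain \<alpha> \<beta> :: complex where "(j < nE \<longrightarrow> \<alpha> = 0) \<and>
      (\<forall>x\<in>S. f x = expsol \<alpha> \<beta> \<kappa> x \<and> f' x = expsol (\<kappa> * \<alpha>) (- (\<kappa> * \<beta>)) \<kappa> x)"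
    unfolding edge_sol_def S_def by (elim exE)
  then have \<alpha>: "j < nE \<Longrightarrow> \<alpha> = 0"
    and f_eq: "\<And>x. x \<in> S \<Longrightarrow> f x = expsol \<alpha> \<beta> \<kappa> x"
      "\<And>x. x \<in> S \<Longrightarrow> f' x = expsol (\<kappa> * \<alpha>) (- (\<kappa> * \<beta>)) \<kappa> x"
    by blast+
  from g obtain \<gamma> \<delta> :: complex where "(j < nE \<longrightarrow> \<gamma> = 0) \<and>
      (\<forall>x\<in>S. g x = expsol \<gamma> \<delta> \<mu> x \<and> g' x = expsol (\<mu> * \<gamma>) (- (\<mu> * \<delta>)) \<mu> x)"
    unfolding edge_sol_def S_def by (elim exE)
  then have \<gamma>: "j < nE \<Longrightarrow> \<gamma> = 0"
    and g_eq: "\<And>x. x \<in> S \<Longrightarrow> g x = expsol \<gamma> \<delta> \<mu> x"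
      "\<And>x. x \<in> S \<Longrightarrow> g' x = expsol (\<mu> * \<gamma>) (- (\<mu> * \<delta>)) \<mu> x"
    by blast+
  let ?F = "\<lambda>x. cnj (expsol \<alpha> \<beta> \<kappa> x) * expsol \<gamma> \<delta> \<mu> x"
  let ?F' = "\<lambda>x. cnj (expsol (\<kappa> * \<alpha>) (- (\<kappa> * \<beta>)) \<kappa> x) * expsol (\<mu> * \<gamma>) (- (\<mu> * \<delta>)) \<mu> x"
  have cong: "integral S (\<lambda>x. cnj (f x) * g x) = integral S ?F"
    "integral S (\<lambda>x. cnj (f' x) * g' x) = integral S ?F'"
    "(\<lambda>x. cnj (f x) * g x) integrable_on S \<longleftrightarrow> ?F integrable_on S"
    "(\<lambda>x. cnj (f' x) * g' x) integrable_on S \<longleftrightarrow> ?F' integrable_on S"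
    by (rule integral_cong integrable_cong; simp only: f_eq g_eq)+
  have "?F integrable_on S \<and> ?F' integrable_on S \<and>
    complex_of_real (\<mu>\<^sup>2) * integral S ?F + integral S ?F' =
      (if j < nE then 0 else cnj (f (a (j - nE))) * g' (a (j - nE))) - cnj (f 0) * g' 0"
  proof (cases "j < nE")
    case True
    then have S: "S = {0..}" by (simp add: S_def edge_interval_def)
    then have 0: "0 \<in> S" by simp
    show ?thesis
      using True green_half_line[OF pos(1,2), where \<beta> = \<beta> and \<delta> = \<delta>] \<alpha> \<gamma>
      unfolding f_eq[OF 0] g_eq[OF 0] by (simp add: S)
  next
    case False
    let ?b = "a (j - nE)"
    have S: "S = {0..?b}" and b: "?b > 0"
      using False pos(3) by (simp_all add: S_def edge_interval_def)
    then have 0: "0 \<in> S" and bS: "?b \<in> S" by simp_all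
    show ?thesis
      using False green_interval[where b = ?b and \<alpha> = \<alpha> and \<beta> = \<beta> and \<kappa> = \<kappa>
          and \<gamma> = \<gamma> and \<delta> = \<delta> and \<mu> = \<mu>] b
      unfolding f_eq[OF 0] g_eq[OF 0] f_eq[OF bS] g_eq[OF bS] by (simp add: S)
  qed
  then show "(\<lambda>x. cnj (f x) * g x) integrable_on S" "(\<lambda>x. cnj (f' x) * g' x) integrable_on S"
    "complex_of_real (\<mu>\<^sup>2) * integral S (\<lambda>x. cnj (f x) * g x) + integral S (\<lambda>x. cnj (f' x) * g' x)
      = (if j < nE then 0 else cnj (f (a (j - nE))) * g' (a (j - nE))) - cnj (f 0) * g' 0"
    unfolding cong by blast+
qed

lemma edge_sol_continuous:
  assumes "edge_sol nE a j \<kappa> f f'"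
  shows "continuous_on (edge_interval nE a j) f"
proof -
  obtain \<alpha> \<beta> where "\<And>x. x \<in> edge_interval nE a j \<Longrightarrow> f x = expsol \<alpha> \<beta> \<kappa> x"
    using assms unfolding edge_sol_def by blast
  then show ?thesis
    by (subst continuous_on_cong[OF refl]) (auto intro: expsol_continuous)
qed

lemma edge_integral_square_pos:
  assumes cont: "continuous_on (edge_interval nE a j) \<phi>"
    and int: "(\<lambda>x. (cmod (\<phi> x))\<^sup>2) integrable_on edge_interval nE a j"
    and x: "x \<in> edge_interval nE a j" "\<phi> x \<noteq> 0"
    and pos: "j \<ge> nE \<Longrightarrow> a (j - nE) > 0"
  shows "integral (edge_interval nE a j) (\<lambda>x. (cmod (\<phi> x))\<^sup>2) > 0"
proof -
  \<comment> \<open>On a half line, x + 1 instead of x keeps the compact interval nondegenerate when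
    x = 0.\<close>
  define r where "r = (if j < nE then x + 1 else a (j - nE))"
  have r: "r > 0" "x \<in> {0..r}" and sub: "{0..r} \<subseteq> edge_interval nE a j"
    using x(1) pos by (auto simp: r_def edge_interval_def split: if_splits)
  have cont': "continuous_on {0..r} (\<lambda>x. (cmod (\<phi> x))\<^sup>2)"
    using continuous_on_subset[OF cont sub] by (intro continuous_intros)
  have "integral {0..r} (\<lambda>x. (cmod (\<phi> x))\<^sup>2) \<noteq> 0"
    using integral_eq_0_iff[OF cont' r(1)] r(2) x(2) by auto
  moreover have "integral {0..r} (\<lambda>x. (cmod (\<phi> x))\<^sup>2) \<ge> 0"
    using cont' by (intro integral_nonneg integrable_continuous_real) auto
  moreover have "integral {0..r} (\<lambda>x. (cmod (\<phi> x))\<^sup>2)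
      \<le> integral (edge_interval nE a j) (\<lambda>x. (cmod (\<phi> x))\<^sup>2)"
    using cont' by (intro integral_subset_le sub int integrable_continuous_real) auto
  ultimately show ?thesis by linarith
qed

definition boundary_form :: "nat \<Rightarrow> nat \<Rightarrow> (nat \<Rightarrow> real) \<Rightarrow>
    (nat \<Rightarrow> real \<Rightarrow> complex) \<Rightarrow> (nat \<Rightarrow> real \<Rightarrow> complex) \<Rightarrow> complex" where
  "boundary_form nE nI a \<psi> \<chi>' =
     (\<Sum>i<nE + 2 * nI. cnj (bval nE nI a \<psi> $ i) * bder nE nI a \<chi>' $ i)"

lemma sum_lessThan_add:
  fixes f :: "nat \<Rightarrow> 'a :: comm_monoid_add"
  shows "(\<Sum>i<m + n. f i) = (\<Sum>i<m. f i) + (\<Sum>i<n. f (m + i))"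
  by (induction n) (simp_all add: add.assoc)

text \<open>The coordinates of K list the initial points of all edges before the far ends of the
  internal ones. Regrouping by edge, with the sign of the inward derivative in \<open>bder\<close>,
  gives the endpoint differences of Green's identity.\<close>

lemma boundary_form_edges:
  "boundary_form nE nI a \<psi> \<chi>' = - (\<Sum>j<nE + nI.
     (if j < nE then 0 else cnj (\<psi> j (a (j - nE))) * \<chi>' j (a (j - nE))) - cnj (\<psi> j 0) * \<chi>' j 0)"
proof -
  have "boundary_form nE nI a \<psi> \<chi>'
      = (\<Sum>i<(nE + nI) + nI. cnj (bval nE nI a \<psi> $ i) * bder nE nI a \<chi>' $ i)"
    by (simp add: boundary_form_def mult_2 add.assoc)
  also have "\<dots> = (\<Sum>j<nE + nI. cnj (\<psi> j 0) * \<chi>' j 0)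
      - (\<Sum>i<nI. cnj (\<psi> (nE + i) (a i)) * \<chi>' (nE + i) (a i))"
    unfolding sum_lessThan_add[of _ "nE + nI"]
    by (simp add: bval_def bder_def sum_negf)
  also have "(\<Sum>i<nI. cnj (\<psi> (nE + i) (a i)) * \<chi>' (nE + i) (a i))
      = (\<Sum>j<nE + nI. if j < nE then 0 else cnj (\<psi> j (a (j - nE))) * \<chi>' j (a (j - nE)))"
    unfolding sum_lessThan_add[of _ nE] by simp
  finally show ?thesis by (simp add: sum_subtractf)
qed

text \<open>Green's identity reads - <psi_k, psi'_l> = kappa_l^2 G_kl + H_kl, where G and H are the Gram matrices of
  the functions and of their derivatives. As all three matrices are hermitian, G_kl = 0 unless
  kappa_k = kappa_l, so the right side is the sum of a positive definite block diagonal form and a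
  positive semidefinite one.\<close>

theorem boundary_form_negative:
  fixes \<kappa> :: "'k \<Rightarrow> real" and \<psi> \<psi>' :: "'k \<Rightarrow> nat \<Rightarrow> real \<Rightarrow> complex"
  assumes K: "finite K" and a: "\<And>i. i < nI \<Longrightarrow> a i > 0" and \<kappa>: "\<And>k. k \<in> K \<Longrightarrow> \<kappa> k > 0"
    and sol: "\<And>k j. k \<in> K \<Longrightarrow> j < nE + nI \<Longrightarrow> edge_sol nE a j (\<kappa> k) (\<psi> k j) (\<psi>' k j)"
    and herm: "\<And>k l. k \<in> K \<Longrightarrow> l \<in> K \<Longrightarrow>
      boundary_form nE nI a (\<psi> l) (\<psi>' k) = cnj (boundary_form nE nI a (\<psi> k) (\<psi>' l))"
    and indep: "\<And>s c k. (\<And>j x. j < nE + nI \<Longrightarrow> x \<in> edge_interval nE a j \<Longrightarrow>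
        (\<Sum>k\<in>{k\<in>K. \<kappa> k = s}. c k * \<psi> k j x) = 0) \<Longrightarrow> k \<in> K \<Longrightarrow> \<kappa> k = s \<Longrightarrow> c k = 0"
    and c: "\<exists>k\<in>K. c k \<noteq> 0"
  shows "\<exists>r>0. (\<Sum>k\<in>K. \<Sum>l\<in>K. cnj (c k) * c l * boundary_form nE nI a (\<psi> k) (\<psi>' l))
    = - complex_of_real r"
proof -
  let ?I = "edge_interval nE a"
  define G where "G k l = (\<Sum>j<nE + nI. integral (?I j) (\<lambda>x. cnj (\<psi> k j x) * \<psi> l j x))" for k l
  define H where "H k l = (\<Sum>j<nE + nI. integral (?I j) (\<lambda>x. cnj (\<psi>' k j x) * \<psi>' l j x))" for k l
  have aj: "a (j - nE) > 0" if "j < nE + nI" "j \<ge> nE" for j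
    using that by (intro a) auto
  note green = edge_green[OF sol sol \<kappa> \<kappa>]
  have form: "- boundary_form nE nI a (\<psi> k) (\<psi>' l) = complex_of_real ((\<kappa> l)\<^sup>2) * G k l + H k l"
    if "k \<in> K" "l \<in> K" for k l
    unfolding boundary_form_edges G_def H_def minus_minus sum_distrib_left sum.distrib[symmetric]
    using that aj by (intro sum.cong refl green(3)[symmetric]) auto
  have cnjG: "cnj (G k l) = G l k" and cnjH: "cnj (H k l) = H l k" for k l
    unfolding G_def H_def by (simp_all add: cnj_sum integral_cnj mult.commute)
  have orth: "G k l = 0" if kl: "k \<in> K" "l \<in> K" and ne: "\<kappa> k \<noteq> \<kappa> l" for k l
  proof -
    have "complex_of_real ((\<kappa> l)\<^sup>2) * G k l + H k l = complex_of_real ((\<kappa> k)\<^sup>2) * G k l + H k l"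
      using form[OF kl] arg_cong[OF form[OF kl(2,1)], of cnj] herm[OF kl]
      by (simp add: cnjG cnjH)
    then have "complex_of_real ((\<kappa> l)\<^sup>2) = complex_of_real ((\<kappa> k)\<^sup>2) \<or> G k l = 0" by auto
    moreover have "(\<kappa> l)\<^sup>2 \<noteq> (\<kappa> k)\<^sup>2"
      using \<kappa>[OF kl(1)] \<kappa>[OF kl(2)] ne by (simp add: power2_eq_iff)
    ultimately show ?thesis by (simp only: of_real_eq_iff) simp
  qed
  define N where "N L j = integral (?I j) (\<lambda>x. (cmod (\<Sum>k\<in>L. c k * \<psi> k j x))\<^sup>2)" for L j
  define N' where "N' j = integral (?I j) (\<lambda>x. (cmod (\<Sum>k\<in>K. c k * \<psi>' k j x))\<^sup>2)" for j
  have gram: "(\<Sum>k\<in>L. \<Sum>l\<in>L. cnj (c k) * c l * G k l) = complex_of_real (\<Sum>j<nE + nI. N L j)"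
    if L: "L \<subseteq> K" for L
  proof -
    have "(\<Sum>k\<in>L. \<Sum>l\<in>L. cnj (c k) * c l * G k l)
        = (\<Sum>k\<in>L. \<Sum>j<nE + nI. \<Sum>l\<in>L. cnj (c k) * c l * integral (?I j) (\<lambda>x. cnj (\<psi> k j x) * \<psi> l j x))"
      unfolding G_def sum_distrib_left by (intro sum.cong refl sum.swap)
    also have "\<dots> = (\<Sum>j<nE + nI. \<Sum>k\<in>L. \<Sum>l\<in>L. cnj (c k) * c l * integral (?I j) (\<lambda>x. cnj (\<psi> k j x) * \<psi> l j x))"
      by (rule sum.swap)
    also have "\<dots> = (\<Sum>j<nE + nI. complex_of_real (N L j))"
      unfolding N_def using L K aj finite_subset[OF L K]
      by (intro sum.cong refl integral_gram(2) green(1)) auto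
    finally show ?thesis by simp
  qed
  have gram': "(\<Sum>k\<in>K. \<Sum>l\<in>K. cnj (c k) * c l * H k l) = complex_of_real (\<Sum>j<nE + nI. N' j)"
  proof -
    have "(\<Sum>k\<in>K. \<Sum>l\<in>K. cnj (c k) * c l * H k l)
        = (\<Sum>k\<in>K. \<Sum>j<nE + nI. \<Sum>l\<in>K. cnj (c k) * c l * integral (?I j) (\<lambda>x. cnj (\<psi>' k j x) * \<psi>' l j x))"
      unfolding H_def sum_distrib_left by (intro sum.cong refl sum.swap)
    also have "\<dots> = (\<Sum>j<nE + nI. \<Sum>k\<in>K. \<Sum>l\<in>K. cnj (c k) * c l * integral (?I j) (\<lambda>x. cnj (\<psi>' k j x) * \<psi>' l j x))"
      by (rule sum.swap)
    also have "\<dots> = (\<Sum>j<nE + nI. complex_of_real (N' j))"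
      unfolding N'_def using K aj
      by (intro sum.cong refl integral_gram(2) green(2)) auto
    finally show ?thesis by simp
  qed
  have int: "(\<lambda>x. (cmod (\<Sum>k\<in>L. c k * \<psi> k j x))\<^sup>2) integrable_on ?I j"
    if "L \<subseteq> K" "j < nE + nI" for L j
    using that aj finite_subset[OF that(1) K] by (intro integral_gram(1) green(1)) auto
  have N_nonneg: "N L j \<ge> 0" if "L \<subseteq> K" "j < nE + nI" for L j
    unfolding N_def by (intro integral_nonneg int that) auto
  have N'_nonneg: "N' j \<ge> 0" if "j < nE + nI" for j
    unfolding N'_def using that aj K by (intro integral_nonneg integral_gram(1) green(2)) auto
  define Ks where "Ks s = {k\<in>K. \<kappa> k = s}" for s
  have Ks: "Ks s \<subseteq> K" for s by (auto simp: Ks_def)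
  \<comment> \<open>Orthogonality removes the pairs of different rates, and within one block the
    factor \<open>(\<kappa> l)\<^sup>2\<close> is the constant \<open>s\<^sup>2\<close>, so only
    weighted squared norms remain.\<close>
  have group: "(\<Sum>k\<in>K. \<Sum>l\<in>K. cnj (c k) * c l * (complex_of_real ((\<kappa> l)\<^sup>2) * G k l))
      = complex_of_real (\<Sum>s\<in>\<kappa> ` K. s\<^sup>2 * (\<Sum>j<nE + nI. N (Ks s) j))"
  proof -
    have "(\<Sum>k\<in>K. \<Sum>l\<in>K. cnj (c k) * c l * (complex_of_real ((\<kappa> l)\<^sup>2) * G k l))
        = (\<Sum>s\<in>\<kappa> ` K. \<Sum>k\<in>Ks s. \<Sum>l\<in>K. cnj (c k) * c l * (complex_of_real ((\<kappa> l)\<^sup>2) * G k l))"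
      unfolding Ks_def by (rule sum.image_gen[OF K])
    also have "\<dots> = (\<Sum>s\<in>\<kappa> ` K. complex_of_real (s\<^sup>2) * (\<Sum>k\<in>Ks s. \<Sum>l\<in>Ks s. cnj (c k) * c l * G k l))"
      unfolding sum_distrib_left
    proof (rule sum.cong[OF refl], rule sum.cong[OF refl])
      fix s k assume "k \<in> Ks s"
      then have k: "k \<in> K" "\<kappa> k = s" by (auto simp: Ks_def)
      have "(\<Sum>l\<in>K. cnj (c k) * c l * (complex_of_real ((\<kappa> l)\<^sup>2) * G k l))
          = (\<Sum>l\<in>Ks s. cnj (c k) * c l * (complex_of_real ((\<kappa> l)\<^sup>2) * G k l))"
        using K Ks orth[OF k(1)] k(2) by (intro sum.mono_neutral_right) (fastforce simp: Ks_def)+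
      also have "\<dots> = (\<Sum>l\<in>Ks s. complex_of_real (s\<^sup>2) * (cnj (c k) * c l * G k l))"
        by (intro sum.cong refl) (auto simp: Ks_def mult_ac)
      finally show "(\<Sum>l\<in>K. cnj (c k) * c l * (complex_of_real ((\<kappa> l)\<^sup>2) * G k l))
          = (\<Sum>l\<in>Ks s. complex_of_real (s\<^sup>2) * (cnj (c k) * c l * G k l))" .
    qed
    also have "\<dots> = complex_of_real (\<Sum>s\<in>\<kappa> ` K. s\<^sup>2 * (\<Sum>j<nE + nI. N (Ks s) j))"
      using gram[OF Ks] by simp
    finally show ?thesis .
  qed
  define r where "r = (\<Sum>s\<in>\<kappa> ` K. s\<^sup>2 * (\<Sum>j<nE + nI. N (Ks s) j)) + (\<Sum>j<nE + nI. N' j)"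
  have "(\<Sum>k\<in>K. \<Sum>l\<in>K. cnj (c k) * c l * boundary_form nE nI a (\<psi> k) (\<psi>' l))
      = - (\<Sum>k\<in>K. \<Sum>l\<in>K. cnj (c k) * c l * (complex_of_real ((\<kappa> l)\<^sup>2) * G k l) + cnj (c k) * c l * H k l)"
    unfolding sum_negf[symmetric]
    by (intro sum.cong refl) (simp add: form[symmetric] distrib_left[symmetric] del: of_real_power)
  also have "\<dots> = - complex_of_real r"
    unfolding sum.distrib group gram' r_def by simp
  finally have eq: "(\<Sum>k\<in>K. \<Sum>l\<in>K. cnj (c k) * c l * boundary_form nE nI a (\<psi> k) (\<psi>' l))
      = - complex_of_real r" .
  \<comment> \<open>Independence within a single rate suffices: the block of a nonzero coefficient
    is a nonzero function on some edge, and its norm already makes r positive since all other terms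
    are nonnegative.\<close>
  obtain k0 where k0: "k0 \<in> K" "c k0 \<noteq> 0" using c by blast
  define s where "s = \<kappa> k0"
  obtain j x where j: "j < nE + nI" and x: "x \<in> ?I j" "(\<Sum>k\<in>Ks s. c k * \<psi> k j x) \<noteq> 0"
    using indep[where s = s and c = c and k = k0] k0 unfolding Ks_def s_def by blast
  have "continuous_on (?I j) (\<lambda>x. \<Sum>k\<in>Ks s. c k * \<psi> k j x)"
    using sol j Ks by (intro continuous_intros edge_sol_continuous) auto
  then have "N (Ks s) j > 0"
    unfolding N_def using x aj[OF j] by (intro edge_integral_square_pos int Ks j) auto
  then have "(\<Sum>j<nE + nI. N (Ks s) j) > 0"
    using j N_nonneg[OF Ks] by (intro sum_pos2[of _ j]) auto
  then have "(\<Sum>s\<in>\<kappa> ` K. s\<^sup>2 * (\<Sum>j<nE + nI. N (Ks s) j)) > 0"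
    using k0 K \<kappa>[OF k0(1)] N_nonneg[OF Ks]
    by (intro sum_pos2[of _ s]) (auto simp: s_def intro!: mult_nonneg_nonneg sum_nonneg)
  then have "r > 0" unfolding r_def using N'_nonneg by (intro add_pos_nonneg sum_nonneg) auto
  with eq show ?thesis by blast
qed

section \<open>Counting negative eigenvalues\<close>

lemma eigenfunction_edge_sol:
  assumes \<Psi>: "\<Psi> \<in> eigenspace_neg_Laplacian nE nI a A B lam" and lam: "lam < 0"
  shows "\<exists>\<Psi>'. A *\<^sub>v bval nE nI a \<Psi> + B *\<^sub>v bder nE nI a \<Psi>' = 0\<^sub>v (nE + 2 * nI) \<and>
    (\<forall>j<nE + nI. edge_sol nE a j (sqrt (- lam)) (\<Psi> j) (\<Psi>' j))"
proof -
  obtain \<Psi>' \<Psi>'' where D: "in_D nE nI a \<Psi> \<Psi>' \<Psi>''"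
    and bc: "A *\<^sub>v bval nE nI a \<Psi> + B *\<^sub>v bder nE nI a \<Psi>' = 0\<^sub>v (nE + 2 * nI)"
    and ev: "\<And>j. j < nE + nI \<Longrightarrow> negligible {x \<in> edge_interval nE a j. - \<Psi>'' j x \<noteq> complex_of_real lam * \<Psi> j x}"
    using \<Psi> unfolding eigenspace_neg_Laplacian_def by blast
  define \<kappa> where "\<kappa> = sqrt (- lam)"
  have \<kappa>: "\<kappa> > 0" "lam = - (\<kappa>\<^sup>2)" using lam by (auto simp: \<kappa>_def)
  have "edge_sol nE a j \<kappa> (\<Psi> j) (\<Psi>' j)" if j: "j < nE + nI" for j
  proof -
    let ?S = "edge_interval nE a j"
    have S: "0 \<le> x \<and> {0..x} \<subseteq> ?S" if "x \<in> ?S" for x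
      using that by (auto simp: edge_interval_def split: if_splits)
    have ac: "abs_cont_with_deriv ?S (\<Psi> j) (\<Psi>' j)" "abs_cont_with_deriv ?S (\<Psi>' j) (\<Psi>'' j)"
      and sq: "square_integrable_on (\<Psi> j) ?S"
      using D j unfolding in_D_def by blast+
    obtain \<alpha> \<beta> :: complex where sol: "\<And>x. x \<in> ?S \<Longrightarrow> \<Psi> j x = expsol \<alpha> \<beta> \<kappa> x"
      "\<And>x. x \<in> ?S \<Longrightarrow> \<Psi>' j x = expsol (\<kappa> * \<alpha>) (- (\<kappa> * \<beta>)) \<kappa> x"
      using ode_explicit_solution[OF S _ ac ev[OF j, unfolded \<kappa>(2)]] \<kappa>(1) by blast
    have "\<alpha> = 0" if "j < nE"
    proof (rule square_integrable_expsol_half_line[OF \<kappa>(1)])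
      have S_eq: "?S = {0..}" using that by (simp add: edge_interval_def)
      have "(\<lambda>x. (cmod (\<Psi> j x))\<^sup>2) integrable_on ?S"
        using sq by (simp add: square_integrable_on_def)
      also have "?this \<longleftrightarrow> (\<lambda>x. (cmod (expsol \<alpha> \<beta> \<kappa> x))\<^sup>2) integrable_on ?S"
        by (rule integrable_cong) (simp add: sol)
      finally show "(\<lambda>x. (cmod (expsol \<alpha> \<beta> \<kappa> x))\<^sup>2) integrable_on {0..}" unfolding S_eq .
    qed
    then show ?thesis unfolding edge_sol_def using sol by blast
  qed
  with bc show ?thesis unfolding \<kappa>_def by blast
qed

text \<open>The unitary W cancels from the product of W P y and W Q z. As P and Q are real,
  exchanging y and z conjugates the result, which is the hermitian symmetry that Green's identity
  needs.\<close>

lemma boundary_form_normal_form: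
  fixes W :: "complex mat"
  assumes W: "W \<in> carrier_mat n n" "mat_adjoint W * W = 1\<^sub>m n" and n: "n = nE + 2 * nI"
    and y: "y \<in> carrier_vec n" "z \<in> carrier_vec n"
    and \<psi>: "bval nE nI a \<psi> = W *\<^sub>v (real_diag n p *\<^sub>v y)"
    and \<chi>': "bder nE nI a \<chi>' = W *\<^sub>v (real_diag n q *\<^sub>v z)"
  shows "boundary_form nE nI a \<psi> \<chi>' = (\<Sum>j<n. complex_of_real (p j * q j) * (cnj (y $ j) * z $ j))"
proof -
  let ?P = "real_diag n p *\<^sub>v y" and ?Q = "real_diag n q *\<^sub>v z"
  have PQ: "?P \<in> carrier_vec n" "?Q \<in> carrier_vec n"
    by (auto simp: real_diag_mult_vec y)
  have "boundary_form nE nI a \<psi> \<chi>' = bder nE nI a \<chi>' \<bullet>c bval nE nI a \<psi>"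
    by (simp add: boundary_form_def scalar_prod_def bval_def bder_def lessThan_atLeast0 mult.commute)
  also have "\<dots> = ?Q \<bullet>c (mat_adjoint W *\<^sub>v (W *\<^sub>v ?P))"
    unfolding \<psi> \<chi>' using W PQ by (intro cscalar_prod_mult_mat) (auto intro: mult_mat_vec_carrier)
  also have "mat_adjoint W *\<^sub>v (W *\<^sub>v ?P) = ?P"
    using W PQ by (simp add: assoc_mult_mat_vec[of _ n n _ n, symmetric])
  also have "?Q \<bullet>c ?P = (\<Sum>j<n. complex_of_real (p j * q j) * (cnj (y $ j) * z $ j))"
    using y by (simp add: real_diag_mult_vec scalar_prod_def lessThan_atLeast0 mult_ac)
  finally show ?thesis .
qed

text \<open>All families are treated at once: the parameters y of the boundary data of their members
  satisfy the positivity hypothesis of \<open>card_le_positive_index\<close> for the weights - p_j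
  q_j.\<close>

lemma sum_card_independent_eigenfunctions_le:
  assumes iso: "max_isotropic_AB (nE + 2 * nI) A B" and a: "\<forall>i<nI. a i > 0"
    and L: "finite L" "\<And>lam. lam \<in> L \<Longrightarrow> lam < 0"
    and F: "\<And>lam. lam \<in> L \<Longrightarrow> F lam \<subseteq> eigenspace_neg_Laplacian nE nI a A B lam \<and> lin_indep_fun (F lam)"
  shows "(\<Sum>lam\<in>L. card (F lam)) \<le> pos_eigenvalue_count (A * mat_adjoint B)"
proof -
  define n where "n = nE + 2 * nI"
  obtain W p q where W: "W \<in> carrier_mat n n" "mat_adjoint W * W = 1\<^sub>m n"
    and "\<forall>y\<in>carrier_vec n.
       A *\<^sub>v (W *\<^sub>v (real_diag n p *\<^sub>v y)) + B *\<^sub>v (W *\<^sub>v (real_diag n q *\<^sub>v y)) = 0\<^sub>v n"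
    and nf: "\<forall>x\<in>carrier_vec n. \<forall>x'\<in>carrier_vec n. A *\<^sub>v x + B *\<^sub>v x' = 0\<^sub>v n \<longrightarrow>
       (\<exists>y\<in>carrier_vec n. x = W *\<^sub>v (real_diag n p *\<^sub>v y) \<and> x' = W *\<^sub>v (real_diag n q *\<^sub>v y))"
    and count: "pos_eigenvalue_count (A * mat_adjoint B) = card {j. j < n \<and> p j * q j < 0}"
    using isotropic_normal_form[OF iso[folded n_def]] .
  \<comment> \<open>Tagging each function with its eigenvalue makes the union disjoint, so that
    \<open>card K\<close> is the sum of the cardinalities.\<close>
  define K where "K = (SIGMA lam:L. F lam)"
  define \<kappa> where "\<kappa> k = sqrt (- fst k)" for k :: "real \<times> (nat \<Rightarrow> real \<Rightarrow> complex)"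
  have finF: "finite (F lam)" if "lam \<in> L" for lam
    using F[OF that] by (simp add: lin_indep_fun_def)
  have K: "finite K" using L finF by (auto simp: K_def)
  have K_D: "fst k \<in> L" "fst k < 0" "snd k \<in> F (fst k)"
    "snd k \<in> eigenspace_neg_Laplacian nE nI a A B (fst k)" if "k \<in> K" for k
  proof -
    show "fst k \<in> L" "snd k \<in> F (fst k)" using that by (auto simp: K_def)
    then show "fst k < 0" "snd k \<in> eigenspace_neg_Laplacian nE nI a A B (fst k)"
      using F L(2) by blast+
  qed
  have "\<forall>k\<in>K. \<exists>\<psi>'. A *\<^sub>v bval nE nI a (snd k) + B *\<^sub>v bder nE nI a \<psi>' = 0\<^sub>v n \<and>
      (\<forall>j<nE + nI. edge_sol nE a j (\<kappa> k) (snd k j) (\<psi>' j))"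
    unfolding n_def \<kappa>_def using K_D(2,4) eigenfunction_edge_sol by blast
  then obtain \<psi>' where bc: "\<And>k. k \<in> K \<Longrightarrow> A *\<^sub>v bval nE nI a (snd k) + B *\<^sub>v bder nE nI a (\<psi>' k) = 0\<^sub>v n"
    and sol: "\<And>k j. k \<in> K \<Longrightarrow> j < nE + nI \<Longrightarrow> edge_sol nE a j (\<kappa> k) (snd k j) (\<psi>' k j)"
    by (metis (no_types, lifting) bchoice)
  have "\<forall>k\<in>K. \<exists>y. y \<in> carrier_vec n \<and> bval nE nI a (snd k) = W *\<^sub>v (real_diag n p *\<^sub>v y) \<and>
      bder nE nI a (\<psi>' k) = W *\<^sub>v (real_diag n q *\<^sub>v y)"
  proof
    fix k assume "k \<in> K"
    moreover have "bval nE nI a (snd k) \<in> carrier_vec n" "bder nE nI a (\<psi>' k) \<in> carrier_vec n"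
      by (simp_all add: bval_def bder_def n_def)
    ultimately show "\<exists>y. y \<in> carrier_vec n \<and>
        bval nE nI a (snd k) = W *\<^sub>v (real_diag n p *\<^sub>v y) \<and> bder nE nI a (\<psi>' k) = W *\<^sub>v (real_diag n q *\<^sub>v y)"
      using nf bc by blast
  qed
  then obtain y where y: "\<And>k. k \<in> K \<Longrightarrow> y k \<in> carrier_vec n"
      "\<And>k. k \<in> K \<Longrightarrow> bval nE nI a (snd k) = W *\<^sub>v (real_diag n p *\<^sub>v y k)"
      "\<And>k. k \<in> K \<Longrightarrow> bder nE nI a (\<psi>' k) = W *\<^sub>v (real_diag n q *\<^sub>v y k)"
    by (metis (no_types, lifting) bchoice)
  have form: "boundary_form nE nI a (snd k) (\<psi>' l)
      = (\<Sum>j<n. complex_of_real (p j * q j) * (cnj (y k $ j) * y l $ j))" if "k \<in> K" "l \<in> K" for k l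
    using that by (intro boundary_form_normal_form[OF W n_def] y)
  have "card K \<le> card {j\<in>{..<n}. - (p j * q j) > 0}"
  proof (rule card_le_positive_index[OF _ K, where y = "\<lambda>k j. y k $ j"])
    fix c :: "real \<times> (nat \<Rightarrow> real \<Rightarrow> complex) \<Rightarrow> complex" assume c: "\<exists>k\<in>K. c k \<noteq> 0"
    have "\<exists>r>0. (\<Sum>k\<in>K. \<Sum>l\<in>K. cnj (c k) * c l * boundary_form nE nI a (snd k) (\<psi>' l)) = - complex_of_real r"
    proof (rule boundary_form_negative[OF K _ _ sol _ _ c])
      show "a i > 0" if "i < nI" for i using a that by blast
      show "\<kappa> k > 0" if "k \<in> K" for k using K_D(2)[OF that] by (simp add: \<kappa>_def)
      show "boundary_form nE nI a (snd l) (\<psi>' k) = cnj (boundary_form nE nI a (snd k) (\<psi>' l))"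
        if "k \<in> K" "l \<in> K" for k l
        using that by (simp add: form cnj_sum mult_ac)
    next
      fix s and d :: "real \<times> (nat \<Rightarrow> real \<Rightarrow> complex) \<Rightarrow> complex" and k
      assume 0: "\<And>j x. j < nE + nI \<Longrightarrow> x \<in> edge_interval nE a j \<Longrightarrow>
          (\<Sum>k\<in>{k\<in>K. \<kappa> k = s}. d k * snd k j x) = 0"
        and k: "k \<in> K" "\<kappa> k = s"
      define lam where "lam = fst k"
      have lam: "lam \<in> L" using K_D(1)[OF k(1)] by (simp add: lam_def)
      \<comment> \<open>The rate determines the eigenvalue, so a block of equal rates is exactly one
        of the given families.\<close>
      have Ks: "{k\<in>K. \<kappa> k = s} = Pair lam ` F lam"
        using lam k(2) by (auto simp: K_def \<kappa>_def lam_def image_iff)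
      have eq0: "(\<lambda>j x. \<Sum>f\<in>F lam. d (lam, f) * f j x) = (\<lambda>j x. 0)"
      proof (intro ext)
        fix j x
        show "(\<Sum>f\<in>F lam. d (lam, f) * f j x) = 0"
        proof (cases "j < nE + nI \<and> x \<in> edge_interval nE a j")
          case True
          then have "(\<Sum>k\<in>Pair lam ` F lam. d k * snd k j x) = 0" using 0 unfolding Ks by blast
          then show ?thesis by (subst (asm) sum.reindex) (auto simp: inj_on_def)
        next
          \<comment> \<open>\<open>lin_indep_fun\<close> asks for vanishing at all arguments, while
            only the edges are controlled; elsewhere every function in D is zero by
            convention.\<close>
          case False
          have "f j x = 0" if f: "f \<in> F lam" for f
          proof -
            obtain f' f'' where "in_D nE nI a f f' f''"
              using F[OF lam] f unfolding eigenspace_neg_Laplacian_def by blast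
            then show ?thesis using False unfolding in_D_def by (meson not_le)
          qed
          then show ?thesis by simp
        qed
      qed
      have "lin_indep_fun (F lam)" using F[OF lam] by blast
      then have "\<forall>c. (\<lambda>j x. \<Sum>f\<in>F lam. c f * f j x) = (\<lambda>j x. 0) \<longrightarrow> (\<forall>f\<in>F lam. c f = 0)"
        unfolding lin_indep_fun_def by (rule conjunct2)
      from mp[OF spec[OF this, of "\<lambda>f. d (lam, f)"] eq0]
      have "\<forall>f\<in>F lam. d (lam, f) = 0" .
      then show "d k = 0" using K_D(3)[OF k(1)] by (metis lam_def prod.collapse)
    qed
    then obtain r where r: "r > 0"
      "(\<Sum>k\<in>K. \<Sum>l\<in>K. cnj (c k) * c l * boundary_form nE nI a (snd k) (\<psi>' l)) = - complex_of_real r"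
      by blast
    have "complex_of_real (\<Sum>j<n. - (p j * q j) * (cmod (\<Sum>k\<in>K. c k * y k $ j))\<^sup>2)
        = - (\<Sum>j<n. complex_of_real (p j * q j) *
            ((\<Sum>k\<in>K. cnj (c k) * cnj (y k $ j)) * (\<Sum>l\<in>K. c l * y l $ j)))"
      by (simp add: complex_norm_square sum_negf mult_ac del: of_real_power)
    also have "\<dots> = - (\<Sum>j<n. \<Sum>k\<in>K. \<Sum>l\<in>K. cnj (c k) * c l *
        (complex_of_real (p j * q j) * (cnj (y k $ j) * y l $ j)))"
      by (simp only: sum_product) (simp add: sum_distrib_left mult_ac)
    also have "\<dots> = - (\<Sum>k\<in>K. \<Sum>j<n. \<Sum>l\<in>K. cnj (c k) * c l *
        (complex_of_real (p j * q j) * (cnj (y k $ j) * y l $ j)))"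
      by (subst sum.swap) (rule refl)
    also have "\<dots> = - (\<Sum>k\<in>K. \<Sum>l\<in>K. cnj (c k) * c l * boundary_form nE nI a (snd k) (\<psi>' l))"
    proof (rule arg_cong[where f = uminus], rule sum.cong[OF refl])
      fix k assume k: "k \<in> K"
      have "(\<Sum>j<n. \<Sum>l\<in>K. cnj (c k) * c l * (complex_of_real (p j * q j) * (cnj (y k $ j) * y l $ j)))
        = (\<Sum>l\<in>K. \<Sum>j<n. cnj (c k) * c l * (complex_of_real (p j * q j) * (cnj (y k $ j) * y l $ j)))"
        by (rule sum.swap)
      also have "\<dots> = (\<Sum>l\<in>K. cnj (c k) * c l * boundary_form nE nI a (snd k) (\<psi>' l))"
        using k by (intro sum.cong refl) (simp only: form sum_distrib_left)
      finally show "(\<Sum>j<n. \<Sum>l\<in>K. cnj (c k) * c l * (complex_of_real (p j * q j) * (cnj (y k $ j) * y l $ j)))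
        = (\<Sum>l\<in>K. cnj (c k) * c l * boundary_form nE nI a (snd k) (\<psi>' l))" .
    qed
    also have "\<dots> = complex_of_real r" unfolding r(2) by simp
    finally show "(\<Sum>j<n. - (p j * q j) * (cmod (\<Sum>k\<in>K. c k * y k $ j))\<^sup>2) > 0"
      using r(1) by (simp only: of_real_eq_iff)
  qed auto
  moreover have "card K = (\<Sum>lam\<in>L. card (F lam))"
    unfolding K_def using L finF by (intro card_SigmaI) auto
  moreover have "{j\<in>{..<n}. - (p j * q j) > 0} = {j. j < n \<and> p j * q j < 0}" by auto
  ultimately show ?thesis by (simp add: count)
qed

text \<open>A uniform bound turns the supremum over families into a maximum, so a dimension in
  \<open>enat\<close> can be exchanged for a concrete family.\<close>

lemma fun_dim_attained:
  assumes "\<And>F. F \<subseteq> S \<Longrightarrow> lin_indep_fun F \<Longrightarrow> card F \<le> n"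
  shows "\<exists>F. F \<subseteq> S \<and> lin_indep_fun F \<and> fun_dim S = enat (card F)"
proof -
  have "lin_indep_fun {}" by (simp add: lin_indep_fun_def)
  then obtain F where F: "F \<subseteq> S" "lin_indep_fun F"
    and max: "\<And>F'. F' \<subseteq> S \<Longrightarrow> lin_indep_fun F' \<Longrightarrow> card F' \<le> card F"
    using ex_has_greatest_nat[of "\<lambda>F. F \<subseteq> S \<and> lin_indep_fun F" "{}" card "Suc n"] assms
    by (auto simp: less_Suc_eq_le)
  have "fun_dim S = enat (card F)"
    unfolding fun_dim_def
  proof (rule antisym)
    show "Sup {enat (card F) |F. F \<subseteq> S \<and> lin_indep_fun F} \<le> enat (card F)"
      using max by (intro Sup_least) auto
    show "enat (card F) \<le> Sup {enat (card F) |F. F \<subseteq> S \<and> lin_indep_fun F}"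
      using F by (intro Sup_upper) blast
  qed
  with F show ?thesis by blast
qed

lemma sum_enat: "(\<Sum>x\<in>A. enat (f x)) = enat (\<Sum>x\<in>A. f x)"
  by (induction A rule: infinite_finite_induct) (auto simp: zero_enat_def)

text \<open>The bound on independent families is used twice: for a single eigenvalue it makes the
  dimension finite and attained, and for the attaining families together it bounds the sum.\<close>

lemma num_neg_eigenvalues_le:
  assumes iso: "max_isotropic_AB (nE + 2 * nI) A B" and a: "\<forall>i<nI. a i > 0"
  shows "num_neg_eigenvalues nE nI a A B \<le> enat (pos_eigenvalue_count (A * mat_adjoint B))"
  unfolding num_neg_eigenvalues_def
proof (rule Sup_least)
  let ?E = "eigenspace_neg_Laplacian nE nI a A B"
  fix m assume "m \<in> {(\<Sum>lam\<in>L. fun_dim (?E lam)) | L.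
    finite L \<and> (\<forall>lam\<in>L. lam < 0 \<and> is_eigenvalue_neg_Laplacian nE nI a A B lam)}"
  then obtain L where L: "finite L" "\<And>lam. lam \<in> L \<Longrightarrow> lam < 0"
    and m: "m = (\<Sum>lam\<in>L. fun_dim (?E lam))" by blast
  have "\<forall>lam\<in>L. \<exists>F. F \<subseteq> ?E lam \<and> lin_indep_fun F \<and> fun_dim (?E lam) = enat (card F)"
  proof
    fix lam assume lam: "lam \<in> L"
    show "\<exists>F. F \<subseteq> ?E lam \<and> lin_indep_fun F \<and> fun_dim (?E lam) = enat (card F)"
      using sum_card_independent_eigenfunctions_le[OF iso a, of "{lam}" "\<lambda>_. F" for F] L(2)[OF lam]
      by (intro fun_dim_attained) auto
  qed
  then obtain F where F: "\<And>lam. lam \<in> L \<Longrightarrow> F lam \<subseteq> ?E lam \<and> lin_indep_fun (F lam) \<and>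
      fun_dim (?E lam) = enat (card (F lam))"
    by (metis (no_types, lifting) bchoice)
  then have "m = enat (\<Sum>lam\<in>L. card (F lam))" unfolding m by (simp add: sum_enat[symmetric])
  then show "m \<le> enat (pos_eigenvalue_count (A * mat_adjoint B))"
    using sum_card_independent_eigenfunctions_le[OF iso a L, of F] F by simp
qed

section \<open>The lower bound on star graphs\<close>

definition decaying_star :: "nat \<Rightarrow> (nat \<Rightarrow> complex) \<Rightarrow> real \<Rightarrow> nat \<Rightarrow> real \<Rightarrow> complex" where
  "decaying_star nE w \<kappa> j x = (if j < nE \<and> x \<ge> 0 then expsol 0 (w j) \<kappa> x else 0)"

lemma abs_cont_with_deriv_expsol:
  assumes f: "\<And>x. x \<ge> 0 \<Longrightarrow> f x = expsol \<alpha> \<beta> \<kappa> x"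
  shows "abs_cont_with_deriv {0..} f (expsol (\<kappa> * \<alpha>) (- (\<kappa> * \<beta>)) \<kappa>)"
proof -
  have "f x = f 0 + integral {0..x} (expsol (\<kappa> * \<alpha>) (- (\<kappa> * \<beta>)) \<kappa>)" if "x \<ge> 0" for x
  proof -
    have "(expsol (\<kappa> * \<alpha>) (- (\<kappa> * \<beta>)) \<kappa> has_integral expsol \<alpha> \<beta> \<kappa> x - expsol \<alpha> \<beta> \<kappa> 0) {0..x}"
      using that by (intro fundamental_theorem_of_calculus expsol_derivative)
    then show ?thesis using that by (simp add: f integral_unique)
  qed
  then show ?thesis
    unfolding abs_cont_with_deriv_def atLeast_iff
    by (intro conjI ballI absolutely_integrable_continuous_real expsol_continuous) blast
qed

lemma square_integrable_on_expsol:
  assumes \<kappa>: "\<kappa> > 0" and f: "\<And>x. x \<ge> 0 \<Longrightarrow> f x = expsol 0 \<beta> \<kappa> x"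
  shows "square_integrable_on f {0..}"
proof -
  have "expsol 0 \<beta> \<kappa> measurable_on UNIV"
    by (intro continuous_imp_measurable_on expsol_continuous)
  then have "(\<lambda>x. if x \<in> {0..} then expsol 0 \<beta> \<kappa> x else 0) measurable_on UNIV"
    by (intro measurable_on_restrict) auto
  also have "(\<lambda>x. if x \<in> {0..} then expsol 0 \<beta> \<kappa> x else 0) = (\<lambda>x. if x \<in> {0..} then f x else 0)"
    by (auto simp: f)
  finally have "f measurable_on {0..}" by (simp only: measurable_on_UNIV)
  moreover have "(\<lambda>x. (cmod (f x))\<^sup>2) integrable_on {0..}"
  proof -
    \<comment> \<open>A sum over one index brings the square into the shape of
      \<open>integral_gram\<close>.\<close>
    have "(\<lambda>x. (cmod (\<Sum>k\<in>{()}. 1 * expsol 0 \<beta> \<kappa> x))\<^sup>2) integrable_on {0..}"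
      by (rule integral_gram(1)) (use has_integral_expsol_half_line[OF \<kappa> \<kappa>] in \<open>auto simp: integrable_on_def\<close>)
    also have "?this \<longleftrightarrow> (\<lambda>x. (cmod (f x))\<^sup>2) integrable_on {0..}"
      by (rule integrable_cong) (simp add: f)
    finally show ?thesis .
  qed
  ultimately show ?thesis by (simp add: square_integrable_on_def)
qed

text \<open>At 0 the function has value w and derivative - kappa w on each half line, so membership
  in the domain is a condition on w alone.\<close>

lemma decaying_star_eigenfunction:
  assumes \<kappa>: "\<kappa> > 0"
    and bc: "A *\<^sub>v Matrix.vec nE w + B *\<^sub>v Matrix.vec nE (\<lambda>j. - (\<kappa> * w j)) = 0\<^sub>v nE"
  shows "decaying_star nE w \<kappa> \<in> eigenspace_neg_Laplacian nE 0 a A B (- (\<kappa>\<^sup>2))"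
proof -
  let ?\<Psi> = "decaying_star nE w \<kappa>"
  define \<Psi>' where "\<Psi>' j = expsol 0 (- (\<kappa> * w j)) \<kappa>" for j
  define \<Psi>'' where "\<Psi>'' j = expsol 0 (- (\<kappa> * - (\<kappa> * w j))) \<kappa>" for j
  have \<Psi>: "?\<Psi> j x = expsol 0 (w j) \<kappa> x" if "j < nE" "x \<ge> 0" for j x
    using that by (simp add: decaying_star_def)
  have "in_D nE 0 a ?\<Psi> \<Psi>' \<Psi>''"
    unfolding in_D_def
  proof (intro conjI allI impI)
    fix j x assume "nE + 0 \<le> j \<or> x \<notin> edge_interval nE a j"
    then show "?\<Psi> j x = 0" by (auto simp: decaying_star_def edge_interval_def)
  next
    fix j assume "j < nE + 0"
    then have j: "j < nE" by simp
    then have I: "edge_interval nE a j = {0..}" by (simp add: edge_interval_def)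
    show "square_integrable_on (?\<Psi> j) (edge_interval nE a j)"
      unfolding I using \<Psi>[OF j] by (rule square_integrable_on_expsol[OF \<kappa>])
    show "square_integrable_on (\<Psi>'' j) (edge_interval nE a j)"
      unfolding I \<Psi>''_def by (rule square_integrable_on_expsol[OF \<kappa> refl])
    show "abs_cont_with_deriv (edge_interval nE a j) (?\<Psi> j) (\<Psi>' j)"
      unfolding I \<Psi>'_def using abs_cont_with_deriv_expsol[of "?\<Psi> j" 0 "w j" \<kappa>] \<Psi>[OF j] by simp
    show "abs_cont_with_deriv (edge_interval nE a j) (\<Psi>' j) (\<Psi>'' j)"
      unfolding I \<Psi>''_def
      using abs_cont_with_deriv_expsol[of "\<Psi>' j" 0 "- (\<kappa> * w j)" \<kappa>] by (simp add: \<Psi>'_def)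
  qed
  moreover have "bval nE 0 a ?\<Psi> = Matrix.vec nE w"
    by (intro eq_vecI) (auto simp: bval_def decaying_star_def expsol_def)
  moreover have "bder nE 0 a \<Psi>' = Matrix.vec nE (\<lambda>j. - (\<kappa> * w j))"
    by (intro eq_vecI) (auto simp: bder_def \<Psi>'_def expsol_def)
  moreover have "negligible {x \<in> edge_interval nE a j. - \<Psi>'' j x \<noteq> complex_of_real (- (\<kappa>\<^sup>2)) * ?\<Psi> j x}"
    if "j < nE" for j
  proof -
    have "{x \<in> edge_interval nE a j. - \<Psi>'' j x \<noteq> complex_of_real (- (\<kappa>\<^sup>2)) * ?\<Psi> j x} = {}"
      using that by (auto simp: edge_interval_def \<Psi> \<Psi>''_def expsol_def power2_eq_square)
    then show ?thesis by (simp only: negligible_empty)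
  qed
  ultimately show ?thesis
    unfolding eigenspace_neg_Laplacian_def using bc
    by (intro CollectI exI[of _ \<Psi>'] exI[of _ \<Psi>'']) simp
qed

lemma num_neg_eigenvalues_star_ge:
  assumes iso: "max_isotropic_AB nE A B"
  shows "enat (pos_eigenvalue_count (A * mat_adjoint B)) \<le> num_neg_eigenvalues nE 0 a A B"
proof -
  obtain W p q where W: "W \<in> carrier_mat nE nE" "mat_adjoint W * W = 1\<^sub>m nE"
    and nf: "\<forall>y\<in>carrier_vec nE.
       A *\<^sub>v (W *\<^sub>v (real_diag nE p *\<^sub>v y)) + B *\<^sub>v (W *\<^sub>v (real_diag nE q *\<^sub>v y)) = 0\<^sub>v nE"
    and "\<forall>x\<in>carrier_vec nE. \<forall>x'\<in>carrier_vec nE. A *\<^sub>v x + B *\<^sub>v x' = 0\<^sub>v nE \<longrightarrow>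
       (\<exists>y\<in>carrier_vec nE. x = W *\<^sub>v (real_diag nE p *\<^sub>v y) \<and> x' = W *\<^sub>v (real_diag nE q *\<^sub>v y))"
    and count: "pos_eigenvalue_count (A * mat_adjoint B) = card {j. j < nE \<and> p j * q j < 0}"
    using isotropic_normal_form[OF iso] .
  define J where "J = {j. j < nE \<and> p j * q j < 0}"
  have J: "finite J" "\<And>j. j \<in> J \<Longrightarrow> j < nE" by (auto simp: J_def)
  define \<kappa> where "\<kappa> j = - (q j / p j)" for j
  have \<kappa>: "\<kappa> j > 0" if "j \<in> J" for j
    using that by (auto simp: J_def \<kappa>_def mult_less_0_iff divide_less_0_iff)
  define \<psi> where "\<psi> j = decaying_star nE (\<lambda>e. W $$ (e, j)) (\<kappa> j)" for j
  define lam where "lam j = - ((\<kappa> j)\<^sup>2)" for j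
  let ?E = "eigenspace_neg_Laplacian nE 0 a A B"
  have orth: "(\<Sum>e<nE. cnj (W $$ (e, i)) * W $$ (e, j)) = (if i = j then 1 else 0)"
    if "i \<in> J" "j \<in> J" for i j
  proof -
    have "(mat_adjoint W * W) $$ (i, j) = (\<Sum>e<nE. cnj (W $$ (e, i)) * W $$ (e, j))"
      using W(1) J(2)[OF that(1)] J(2)[OF that(2)] by (simp add: scalar_prod_def lessThan_atLeast0)
    then show ?thesis unfolding W(2) using J(2)[OF that(1)] J(2)[OF that(2)] by simp
  qed
  have \<psi>0: "\<psi> j e 0 = W $$ (e, j)" if "e < nE" for j e
    using that by (simp add: \<psi>_def decaying_star_def expsol_def)
  have in_E: "\<psi> j \<in> ?E (lam j)" if j: "j \<in> J" for j
    unfolding \<psi>_def lam_def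
  proof (rule decaying_star_eigenfunction[OF \<kappa>[OF j]])
    have jn: "j < nE" and p0: "p j \<noteq> 0" using j by (auto simp: J_def)
    \<comment> \<open>The j-th unit vector divided by p_j: then W P y is column j of W, and W Q y is
      q_j / p_j = - kappa_j times that column.\<close>
    define y where "y = Matrix.vec nE (\<lambda>i. if i = j then complex_of_real (1 / p j) else 0)"
    have y: "y \<in> carrier_vec nE" by (simp add: y_def)
    have Wd: "W *\<^sub>v (real_diag nE d *\<^sub>v y) = Matrix.vec nE (\<lambda>e. complex_of_real (d j / p j) * W $$ (e, j))" for d
    proof (rule eq_vecI)
      fix e assume "e < dim_vec (Matrix.vec nE (\<lambda>e. complex_of_real (d j / p j) * W $$ (e, j)))"
      then have e: "e < nE" by simp
      have "(W *\<^sub>v (real_diag nE d *\<^sub>v y)) $ e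
          = (\<Sum>i<nE. W $$ (e, i) * (complex_of_real (d i) * (if i = j then complex_of_real (1 / p j) else 0)))"
        using W(1) e by (simp add: real_diag_mult_vec[OF y] scalar_prod_def lessThan_atLeast0)
          (simp add: y_def)
      also have "\<dots> = (\<Sum>i<nE. if i = j then complex_of_real (d j / p j) * W $$ (e, j) else 0)"
        by (intro sum.cong refl) auto
      also have "\<dots> = complex_of_real (d j / p j) * W $$ (e, j)"
        using jn by simp
      finally show "(W *\<^sub>v (real_diag nE d *\<^sub>v y)) $ e
          = Matrix.vec nE (\<lambda>e. complex_of_real (d j / p j) * W $$ (e, j)) $ e"
        using e by simp
    qed (use W(1) in simp)
    show "A *\<^sub>v Matrix.vec nE (\<lambda>e. W $$ (e, j)) + B *\<^sub>v Matrix.vec nE (\<lambda>e. - (\<kappa> j * W $$ (e, j))) = 0\<^sub>v nE"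
      using bspec[OF nf y] p0 unfolding Wd by (simp add: \<kappa>_def)
  qed
  have nonzero: "\<psi> j \<noteq> (\<lambda>e x. 0)" if j: "j \<in> J" for j
  proof
    assume "\<psi> j = (\<lambda>e x. 0)"
    then have "W $$ (e, j) = 0" if "e < nE" for e using \<psi>0[OF that, of j] by simp
    then show False using orth[OF j j] by simp
  qed
  \<comment> \<open>Dimensions are counted by sets of functions, so different indices must give
    different functions, even for equal rates.\<close>
  have inj: "inj_on \<psi> J"
  proof (rule inj_onI)
    fix i j assume ij: "i \<in> J" "j \<in> J" "\<psi> i = \<psi> j"
    then have "W $$ (e, i) = W $$ (e, j)" if "e < nE" for e
      using \<psi>0[OF that, of i] \<psi>0[OF that, of j] by simp
    then have "(\<Sum>e<nE. cnj (W $$ (e, i)) * W $$ (e, j)) = (\<Sum>e<nE. cnj (W $$ (e, i)) * W $$ (e, i))"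
      by (intro sum.cong) auto
    then show "i = j" using orth[OF ij(1,2)] orth[OF ij(1,1)] by (simp split: if_splits)
  qed
  have indep: "lin_indep_fun (\<psi> ` J')" if J': "J' \<subseteq> J" for J'
    unfolding lin_indep_fun_def
  proof (intro conjI allI impI ballI)
    show fin: "finite (\<psi> ` J')" using J(1) J' finite_subset by blast
    \<comment> \<open>Evaluating the relation at x = 0 leaves a relation between columns of W,
      whatever the rates are; pairing it with column i isolates one coefficient.\<close>
    fix c f assume 0: "(\<lambda>e x. \<Sum>f\<in>\<psi> ` J'. c f * f e x) = (\<lambda>e x. 0)" and "f \<in> \<psi> ` J'"
    then obtain i where i: "i \<in> J'" "f = \<psi> i" by blast
    have inj': "inj_on \<psi> J'" using inj J' by (rule inj_on_subset)
    have "(\<Sum>j\<in>J'. c (\<psi> j) * W $$ (e, j)) = 0" if e: "e < nE" for e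
    proof -
      have "(\<Sum>f\<in>\<psi> ` J'. c f * f e 0) = 0" using fun_cong[OF fun_cong[OF 0]] by simp
      then show ?thesis by (simp add: sum.reindex[OF inj'] \<psi>0[OF e])
    qed
    then have "0 = (\<Sum>e<nE. cnj (W $$ (e, i)) * (\<Sum>j\<in>J'. c (\<psi> j) * W $$ (e, j)))" by simp
    also have "\<dots> = (\<Sum>j\<in>J'. \<Sum>e<nE. cnj (W $$ (e, i)) * (c (\<psi> j) * W $$ (e, j)))"
      by (simp only: sum_distrib_left) (rule sum.swap)
    also have "\<dots> = (\<Sum>j\<in>J'. c (\<psi> j) * (\<Sum>e<nE. cnj (W $$ (e, i)) * W $$ (e, j)))"
      by (simp add: sum_distrib_left mult_ac)
    also have "\<dots> = (\<Sum>j\<in>J'. if j = i then c (\<psi> i) else 0)"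
      using i J' by (intro sum.cong refl) (auto simp: orth subset_iff)
    also have "\<dots> = c (\<psi> i)" using i(1) finite_subset[OF J' J(1)] by simp
    finally show "c f = 0" by (simp add: i(2))
  qed
  \<comment> \<open>Several indices may share one rate, so J is split into the fibres of
    \<open>lam\<close>, each of which bounds the dimension of one eigenspace from below.\<close>
  let ?J = "\<lambda>l. {j\<in>J. lam j = l}"
  have dim: "enat (card (?J l)) \<le> fun_dim (?E l)" for l
  proof -
    have "\<psi> ` ?J l \<subseteq> ?E l" using in_E by auto
    moreover have "lin_indep_fun (\<psi> ` ?J l)" by (rule indep) auto
    ultimately have "enat (card (\<psi> ` ?J l)) \<le> fun_dim (?E l)"
      unfolding fun_dim_def by (intro Sup_upper CollectI exI[of _ "\<psi> ` ?J l"] conjI) simp_all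
    moreover have "card (\<psi> ` ?J l) = card (?J l)"
      by (rule card_image[OF inj_on_subset[OF inj]]) auto
    ultimately show ?thesis by simp
  qed
  have "card J = (\<Sum>l\<in>lam ` J. card (?J l))"
    using sum.image_gen[OF J(1), of "\<lambda>_. 1::nat" lam] by simp
  then have "enat (card J) = (\<Sum>l\<in>lam ` J. enat (card (?J l)))" by (simp add: sum_enat)
  also have "\<dots> \<le> (\<Sum>l\<in>lam ` J. fun_dim (?E l))"
    by (intro sum_mono dim)
  also have "\<dots> \<le> num_neg_eigenvalues nE 0 a A B"
    unfolding num_neg_eigenvalues_def
  proof (rule Sup_upper, rule CollectI, intro exI conjI ballI)
    show "finite (lam ` J)" using J(1) by simp
    fix l assume "l \<in> lam ` J"
    then obtain j where j: "j \<in> J" "l = lam j" by blast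
    show "l < 0" using \<kappa>[OF j(1)] by (simp add: j(2) lam_def)
    show "is_eigenvalue_neg_Laplacian nE 0 a A B l"
      unfolding is_eigenvalue_neg_Laplacian_def j(2) using in_E[OF j(1)] nonzero[OF j(1)] by blast
  qed simp
  finally show ?thesis by (simp add: count J_def)
qed

theorem theorem3p7:
  fixes V :: "'v set" and nE nI :: nat
    and bdE bdM bdP :: "nat \<Rightarrow> 'v"
    and a :: "nat \<Rightarrow> real"
    and A B :: "complex mat"
  assumes "finite_connected_graph V nE nI bdE bdM bdP"
    and "\<forall>i<nI. a i > 0"
    and "max_isotropic_AB (nE + 2 * nI) A B"
  shows "num_neg_eigenvalues nE nI a A B \<le> enat (n_plus A B) \<and>
         (nI = 0 \<longrightarrow> num_neg_eigenvalues nE nI a A B = enat (n_plus A B))"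
proof -
  have n: "n_plus A B = pos_eigenvalue_count (A * mat_adjoint B)"
    by (simp add: n_plus_def pos_eigenvalue_count_def)
  have le: "num_neg_eigenvalues nE nI a A B \<le> enat (n_plus A B)"
    unfolding n using assms(3,2) by (rule num_neg_eigenvalues_le)
  moreover have "enat (n_plus A B) \<le> num_neg_eigenvalues nE nI a A B" if "nI = 0"
    using num_neg_eigenvalues_star_ge[of nE A B a] assms(3) that by (simp add: n)
  ultimately show ?thesis by (auto intro: antisym)
qed

end
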